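(* Let $(X,d)$ be a Polish metric space and let $a,b>0$. Then $\left(\mathcal{M}(X),W_1^{a,b}\right)$ is a geodesic space.
   Context: A Polish metric space is a complete separable metric space. A metric space is geodesic if any two of its points are joined by a continuous curve whose length equals the distance between the two points. $\mathcal{M}(X)$ is the set of nonnegative Borel measures on $X$ with finite mass; $\mathcal{M}_1(X)$ is the set of $\mu\in\mathcal{M}(X)$ with $\int_X d(x,x_0)\,d\mu(x)<\infty$ for some (equivalently any) $x_0\in X$. For $\mu\in\mathcal{M}(X)$, $|\mu|:=\mu(X)$, and $|\mu-\nu|$ denotes the total variation mass of the signed measure $\mu-\nu$. For $\mu,\nu\in\mathcal{M}(X)$ with $|\mu|=|\nu|$, $\Pi(\mu,\nu)$ is the set of Borel probability measures $\pi$ on $X\times X$ with $|\mu|\pi(A\times X)=\mu(A)$ and $|\nu|\pi(X\times B)=\nu(B)$ for all Borel $A,B\subset X$; for $\mu,\nu\in\mathcal{M}_1(X)$ with $|\mu|=|\nu|$, $W_1(\mu,\nu):=|\mu|\inf_{\pi\in\Pi(\mu,\nu)}\int_{X\times X}d(x,y)\,d\pi(x,y)$. Generalized Wasserstein distance: for $a,b>0$ and $\mu,\nu\in\mathcal{M}(X)$, $$W_1^{a,b}(\mu,\nu):=\inf\{a|\mu-\widetilde\mu|+a|\nu-\widetilde\nu|+b\,W_1(\widetilde\mu,\widetilde\nu)\;:\;\widetilde\mu,\widetilde\nu\in\mathcal{M}_1(X),\ |\widetilde\mu|=|\widetilde\nu|\};$$ it is a metric on $\mathcal{M}(X)$. 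*)

theory Defs
  imports "HOL-Probability.Probability"
begin

text \<open>The underlying space is a type of class \<^class>\<open>polish_space\<close>, that is, a complete, second
  countable (equivalently, separable) metric space with distance \<^const>\<open>dist\<close>.\<close>

definition finite_borel_measures :: "'a::topological_space measure set" where
  "finite_borel_measures = {\<mu>. sets \<mu> = sets borel \<and> finite_measure \<mu>}"

definition finite_borel_measures1 :: "'a::metric_space measure set" where
  "finite_borel_measures1 =
    {\<mu> \<in> finite_borel_measures. \<exists>x\<^sub>0. (\<integral>\<^sup>+x. ennreal (dist x x\<^sub>0) \<partial>\<mu>) < \<infinity>}"

text \<open>The total variation mass of a finite signed Borel measure, given as a real-valued set function:
  the supremum over the finite Borel partitions of the whole space.\<close>

definition total_variation :: "('a::topological_space set \<Rightarrow> real) \<Rightarrow> ennreal" where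
  "total_variation \<sigma> =
    (SUP P\<in>{P. finite P \<and> P \<subseteq> sets borel \<and> partition_on UNIV P}. \<Sum>A\<in>P. ennreal \<bar>\<sigma> A\<bar>)"

abbreviation tv_dist :: "'a::topological_space measure \<Rightarrow> 'a measure \<Rightarrow> ennreal" where
  "tv_dist \<mu> \<nu> \<equiv> total_variation (\<lambda>A. measure \<mu> A - measure \<nu> A)"

text \<open>Transport plans are normalised to probability measures; the total mass reappears as a factor
  in \<open>wasserstein1\<close>. The measures are meant to have equal mass. If both are zero, every probability
  measure is a plan, and the factor makes the cost zero.\<close>

definition transport_plans ::
    "'a::topological_space measure \<Rightarrow> 'a measure \<Rightarrow> ('a \<times> 'a) measure set" where
  "transport_plans \<mu> \<nu> =
    {\<pi>. sets \<pi> = sets borel \<and> prob_space \<pi> \<and>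
        (\<forall>A\<in>sets borel. emeasure \<mu> UNIV * emeasure \<pi> (A \<times> UNIV) = emeasure \<mu> A) \<and>
        (\<forall>B\<in>sets borel. emeasure \<nu> UNIV * emeasure \<pi> (UNIV \<times> B) = emeasure \<nu> B)}"

definition wasserstein1 :: "'a::metric_space measure \<Rightarrow> 'a measure \<Rightarrow> ennreal" where
  "wasserstein1 \<mu> \<nu> =
    emeasure \<mu> UNIV *
      (INF \<pi>\<in>transport_plans \<mu> \<nu>. \<integral>\<^sup>+z. ennreal (dist (fst z) (snd z)) \<partial>\<pi>)"

text \<open>For finite \<open>\<mu>\<close> and \<open>\<nu>\<close> the infimum is finite, as the choice \<open>\<mu>' = \<nu>' = 0\<close> shows, so
  \<^const>\<open>enn2real\<close> loses nothing.\<close>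

definition gen_wasserstein1 ::
    "real \<Rightarrow> real \<Rightarrow> 'a::metric_space measure \<Rightarrow> 'a measure \<Rightarrow> real" where
  "gen_wasserstein1 a b \<mu> \<nu> = enn2real
    (INF (\<mu>', \<nu>') \<in> {(\<mu>', \<nu>'). \<mu>' \<in> finite_borel_measures1 \<and> \<nu>' \<in> finite_borel_measures1 \<and>
                           emeasure \<mu>' UNIV = emeasure \<nu>' UNIV}.
      ennreal a * tv_dist \<mu> \<mu>' + ennreal a * tv_dist \<nu> \<nu>' + ennreal b * wasserstein1 \<mu>' \<nu>')"

text \<open>The length of a curve on \<open>[0, 1]\<close>: the supremum of the lengths of inscribed polygons over all
  subdivisions \<open>0 = t 0 \<le> \<dots> \<le> t n = 1\<close>.\<close>

definition curve_length :: "('b \<Rightarrow> 'b \<Rightarrow> real) \<Rightarrow> (real \<Rightarrow> 'b) \<Rightarrow> ennreal" where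
  "curve_length d \<gamma> =
    (SUP (n, t) \<in> {(n :: nat, t). mono_on {..n} t \<and> t 0 = 0 \<and> t n = 1}.
      \<Sum>i<n. ennreal (d (\<gamma> (t i)) (\<gamma> (t (Suc i)))))"

definition geodesic_space :: "'b set \<Rightarrow> ('b \<Rightarrow> 'b \<Rightarrow> real) \<Rightarrow> bool" where
  "geodesic_space S d \<longleftrightarrow>
    Metric_space S d \<and>
    (\<forall>x\<in>S. \<forall>y\<in>S. \<exists>\<gamma>. pathin (Metric_space.mtopology S d) \<gamma> \<and> \<gamma> 0 = x \<and> \<gamma> 1 = y \<and>
      curve_length d \<gamma> = ennreal (d x y))"

end

theory Submission
  imports Defs
begin

text \<open>Geodesics are straight segments: for all finite measures \<open>\<mu>\<close> and \<open>\<nu>\<close> the curve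
\<open>\<gamma> t = (1 - t) \<mu> + t \<nu>\<close> satisfies \<open>W (\<gamma> s) (\<gamma> t) \<le> (t - s) W \<mu> \<nu>\<close> for \<open>s \<le> t\<close>, where \<open>W\<close> is the generalized
Wasserstein distance, and such a curve is continuous and has length \<open>W \<mu> \<nu>\<close>. The base space may lack
geodesics, since mass is removed at one place and created at another instead of being moved through
the space. The estimate holds because \<open>W\<close> is positively homogeneous and does not increase when both
measures receive the same additional measure, which can rest on the diagonal of a transport plan
(\<open>unbalanced_cost_segment_le\<close>).

To make such manipulations possible, \<open>W\<close> is rewritten as a single infimum over all finite measures
\<open>\<pi>\<close> on pairs of points, of the transport cost of \<open>\<pi>\<close> and the penalties for the deviations of its
marginals from \<open>\<mu>\<close> and \<open>\<nu>\<close> (\<open>gen_wasserstein1_eq_unbalanced_cost\<close>). The moment condition disappears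
because every plan can be truncated to a bounded set at a small expense.

A geodesic space is in particular a metric space. The triangle inequality
(\<open>unbalanced_cost_triangle\<close>) comes from gluing two plans. The middle marginals of the two plans
differ, and instead of disintegrating the plans along them, one glues independently within the small cells of a
countable partition, as far as the masses of the cells allow, which causes an arbitrarily small error
(\<open>approximate_gluing\<close>). Distinct measures have positive distance because a plan of small cost with
almost correct marginals can move only little mass out of a neighbourhood of a closed set
(\<open>closed_mass_le\<close>).\<close>

section \<open>Total variation\<close>

lemma total_variation_leI:
  assumes "\<And>P. finite P \<Longrightarrow> P \<subseteq> sets borel \<Longrightarrow> partition_on UNIV P \<Longrightarrow> (\<Sum>A\<in>P. ennreal \<bar>\<sigma> A\<bar>) \<le> c"
  shows "total_variation \<sigma> \<le> c"
  unfolding total_variation_def by (rule SUP_least) (use assms in auto)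

lemma sum_le_total_variation:
  assumes "finite P" "P \<subseteq> sets borel" "partition_on UNIV P"
  shows "(\<Sum>A\<in>P. ennreal \<bar>\<sigma> A\<bar>) \<le> total_variation \<sigma>"
  unfolding total_variation_def by (rule SUP_upper) (use assms in auto)

lemma total_variation_add_le:
  "total_variation (\<lambda>A. \<sigma> A + \<tau> A) \<le> total_variation \<sigma> + total_variation \<tau>"
proof (rule total_variation_leI)
  fix P :: "'a set set"
  assume P: "finite P" "P \<subseteq> sets borel" "partition_on UNIV P"
  have "(\<Sum>A\<in>P. ennreal \<bar>\<sigma> A + \<tau> A\<bar>) \<le> (\<Sum>A\<in>P. ennreal \<bar>\<sigma> A\<bar> + ennreal \<bar>\<tau> A\<bar>)"
    by (intro sum_mono) (simp flip: ennreal_plus)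
  also have "\<dots> \<le> total_variation \<sigma> + total_variation \<tau>"
    unfolding sum.distrib by (intro add_mono sum_le_total_variation P)
  finally show "(\<Sum>A\<in>P. ennreal \<bar>\<sigma> A + \<tau> A\<bar>) \<le> total_variation \<sigma> + total_variation \<tau>" .
qed

lemma tv_dist_triangle: "tv_dist \<mu> \<rho> \<le> tv_dist \<mu> \<nu> + tv_dist \<nu> \<rho>"
  using total_variation_add_le[of "\<lambda>A. measure \<mu> A - measure \<nu> A" "\<lambda>A. measure \<nu> A - measure \<rho> A"]
  by simp

lemma tv_dist_commute: "tv_dist \<mu> \<nu> = tv_dist \<nu> \<mu>"
  by (simp add: total_variation_def abs_minus_commute)

lemma total_variation_scale_le:
  assumes "c \<ge> 0" and "\<And>A. A \<in> sets borel \<Longrightarrow> \<sigma> A = c * \<tau> A"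
  shows "total_variation \<sigma> \<le> ennreal c * total_variation \<tau>"
proof (rule total_variation_leI)
  fix P :: "'a set set"
  assume P: "finite P" "P \<subseteq> sets borel" "partition_on UNIV P"
  have "(\<Sum>A\<in>P. ennreal \<bar>\<sigma> A\<bar>) = (\<Sum>A\<in>P. ennreal c * ennreal \<bar>\<tau> A\<bar>)"
    using P(2) assms by (intro sum.cong) (auto simp: abs_mult ennreal_mult)
  also have "\<dots> \<le> ennreal c * total_variation \<tau>"
    unfolding sum_distrib_left[symmetric] by (intro mult_left_mono sum_le_total_variation P) simp
  finally show "(\<Sum>A\<in>P. ennreal \<bar>\<sigma> A\<bar>) \<le> ennreal c * total_variation \<tau>" .
qed

text \<open>Testing the variation on a set and its complement is all that is ever needed from below: it
bounds differences of masses, and for the set where one of two measures dominates the other on the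
cells of a partition it bounds the mass that cannot be matched.\<close>

lemma total_variation_ge_two_sets:
  assumes "A \<in> sets borel" and "\<sigma> {} = 0"
  shows "ennreal (\<bar>\<sigma> A\<bar> + \<bar>\<sigma> (- A)\<bar>) \<le> total_variation \<sigma>"
\<comment> \<open>A partition has no empty member, so the two trivial sets need the one-element partition.\<close>
proof (cases "A = {} \<or> A = UNIV")
  case True
  have "(\<Sum>B\<in>{UNIV}. ennreal \<bar>\<sigma> B\<bar>) \<le> total_variation \<sigma>"
    by (intro sum_le_total_variation) (auto simp: partition_on_def)
  then show ?thesis using True assms(2) by auto
next
  case False
  have "(\<Sum>B\<in>{A, -A}. ennreal \<bar>\<sigma> B\<bar>) \<le> total_variation \<sigma>"
    using False assms(1)
    by (intro sum_le_total_variation) (auto simp: partition_on_def pairwise_def disjnt_def)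
  moreover have "A \<noteq> - A" by auto
  ultimately show ?thesis by (simp add: ennreal_plus)
qed

lemma finite_borel_measuresD:
  assumes "\<mu> \<in> finite_borel_measures"
  shows "sets \<mu> = sets borel" and "finite_measure \<mu>" and "space \<mu> = UNIV"
  using assms sets_eq_imp_space_eq[of \<mu> borel] by (auto simp: finite_borel_measures_def)

text \<open>When one measure lies below the other, all differences have the same sign and add up over a
partition to the difference of the masses.\<close>

lemma tv_dist_le_mass_diff:
  assumes M: "\<mu> \<in> finite_borel_measures" "\<nu> \<in> finite_borel_measures"
    and le: "\<And>A. A \<in> sets borel \<Longrightarrow> measure \<nu> A \<le> measure \<mu> A"
  shows "tv_dist \<mu> \<nu> \<le> ennreal (measure \<mu> UNIV - measure \<nu> UNIV)"
proof (rule total_variation_leI)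
  fix P :: "'a set set"
  assume P: "finite P" "P \<subseteq> sets borel" "partition_on UNIV P"
  have mass: "(\<Sum>A\<in>P. measure \<rho> A) = measure \<rho> UNIV" if "\<rho> \<in> finite_borel_measures" for \<rho> :: "'a measure"
  proof -
    interpret finite_measure \<rho> using finite_borel_measuresD[OF that] by simp
    have "measure \<rho> (\<Union>A\<in>P. A) = (\<Sum>A\<in>P. measure \<rho> A)"
      using P finite_borel_measuresD[OF that]
      by (intro measure_finite_Union)
        (auto simp: partition_on_def pairwise_def disjoint_family_on_def disjnt_def)
    then show ?thesis using P(3) by (simp add: partition_on_def)
  qed
  have "(\<Sum>A\<in>P. ennreal \<bar>measure \<mu> A - measure \<nu> A\<bar>) = (\<Sum>A\<in>P. ennreal (measure \<mu> A - measure \<nu> A))"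
    using P(2) le by (intro sum.cong) (auto simp: subset_iff)
  also have "\<dots> = ennreal (\<Sum>A\<in>P. measure \<mu> A - measure \<nu> A)"
    using P(2) le by (intro sum_ennreal) (auto simp: subset_iff)
  also have "\<dots> = ennreal (measure \<mu> UNIV - measure \<nu> UNIV)"
    by (simp add: sum_subtractf mass M)
  finally show "(\<Sum>A\<in>P. ennreal \<bar>measure \<mu> A - measure \<nu> A\<bar>) \<le> ennreal (measure \<mu> UNIV - measure \<nu> UNIV)"
    by simp
qed

text \<open>The one-sided form of \<open>\<bar>\<mu> A - \<nu> A\<bar> \<le> \<bar>\<mu> - \<nu>\<bar>\<close> that chains without subtraction in \<^typ>\<open>ennreal\<close>.\<close>

lemma measure_diff_le_tv_dist:
  assumes "A \<in> sets borel"
  shows "ennreal (measure \<mu> A) \<le> ennreal (measure \<nu> A) + tv_dist \<mu> \<nu>"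
proof -
  have "ennreal (measure \<mu> A) \<le> ennreal (measure \<nu> A + (\<bar>measure \<mu> A - measure \<nu> A\<bar> + \<bar>measure \<mu> (-A) - measure \<nu> (-A)\<bar>))"
    by (intro ennreal_leI) linarith
  also have "\<dots> = ennreal (measure \<nu> A) + ennreal (\<bar>measure \<mu> A - measure \<nu> A\<bar> + \<bar>measure \<mu> (-A) - measure \<nu> (-A)\<bar>)"
    by (intro ennreal_plus) auto
  also have "\<dots> \<le> ennreal (measure \<nu> A) + tv_dist \<mu> \<nu>"
    using assms by (intro add_left_mono total_variation_ge_two_sets) auto
  finally show ?thesis .
qed

lemma tv_dist_null_finite:
  assumes "\<mu> \<in> finite_borel_measures"
  shows "tv_dist \<mu> (null_measure borel) < top"
proof -
  have "null_measure borel \<in> (finite_borel_measures :: 'a measure set)"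
    by (auto simp: finite_borel_measures_def intro!: finite_measureI)
  from tv_dist_le_mass_diff[OF assms this] show ?thesis by (simp add: le_less_trans)
qed

section \<open>Sums of measures\<close>

definition add_measure :: "'a measure \<Rightarrow> 'a measure \<Rightarrow> 'a measure" where
  "add_measure \<mu> \<nu> = measure_of (space \<mu>) (sets \<mu>) (\<lambda>A. emeasure \<mu> A + emeasure \<nu> A)"

lemma sets_add_measure [simp]: "sets (add_measure \<mu> \<nu>) = sets \<mu>"
  and space_add_measure [simp]: "space (add_measure \<mu> \<nu>) = space \<mu>"
  by (simp_all add: add_measure_def)

lemma emeasure_add_measure:
  assumes "sets \<nu> = sets \<mu>"
  shows "emeasure (add_measure \<mu> \<nu>) A = emeasure \<mu> A + emeasure \<nu> A"
proof (cases "A \<in> sets \<mu>")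
  case True
  show ?thesis unfolding add_measure_def
  proof (rule emeasure_measure_of_sigma)
    show "countably_additive (sets \<mu>) (\<lambda>A. emeasure \<mu> A + emeasure \<nu> A)"
      unfolding countably_additive_def
      using assms by (auto simp: suminf_add[symmetric] suminf_emeasure)
  qed (use True in \<open>auto simp: positive_def sets.sigma_algebra_axioms\<close>)
qed (simp add: assms emeasure_notin_sets)

lemma nn_integral_add_measure:
  assumes sets: "sets \<nu> = sets \<mu>" and "f \<in> borel_measurable \<mu>"
  shows "(\<integral>\<^sup>+x. f x \<partial>add_measure \<mu> \<nu>) = (\<integral>\<^sup>+x. f x \<partial>\<mu>) + (\<integral>\<^sup>+x. f x \<partial>\<nu>)"
proof -
  let ?S = "{\<mu>, \<nu>, add_measure \<mu> \<nu>}"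
  have sets': "sets \<rho> = sets \<mu>" if "\<rho> \<in> ?S" for \<rho>
    using that sets by (elim insertE emptyE) (simp_all only: sets_add_measure)
  have meas: "w \<in> borel_measurable \<rho>" if "w \<in> borel_measurable \<mu>" "\<rho> \<in> ?S" for w :: "_ \<Rightarrow> ennreal" and \<rho>
    using that(1) by (simp only: measurable_cong_sets[OF sets'[OF that(2)] refl])
  note space = sets_eq_imp_space_eq[OF sets']
  from assms(2) show ?thesis
  proof (induction rule: borel_measurable_induct)
    case (cong f g)
    have "integral\<^sup>N \<rho> f = integral\<^sup>N \<rho> g" if "\<rho> \<in> ?S" for \<rho>
      by (rule nn_integral_cong) (use space[OF that] cong(3) in simp)
    with cong.IH show ?case by simp
  next
    case (set A)
    then show ?case by (simp add: sets emeasure_add_measure)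
  next
    case (mult u c)
    have "(\<integral>\<^sup>+x. c * u x \<partial>\<rho>) = c * integral\<^sup>N \<rho> u" if "\<rho> \<in> ?S" for \<rho>
      by (rule nn_integral_cmult) (rule meas[OF mult(2) that])
    with mult.IH show ?case by (simp add: distrib_left)
  next
    case (add u v)
    have "(\<integral>\<^sup>+x. v x + u x \<partial>\<rho>) = integral\<^sup>N \<rho> v + integral\<^sup>N \<rho> u" if "\<rho> \<in> ?S" for \<rho>
      by (rule nn_integral_add; rule meas[OF _ that]) (rule add)+
    with add.IH show ?case by (simp add: ac_simps)
  next
    case (seq U)
    have mono: "incseq (\<lambda>i. integral\<^sup>N \<rho> (U i))" for \<rho>
      using seq(3) by (auto simp: incseq_def le_fun_def intro!: nn_integral_mono)
    have "(\<integral>\<^sup>+x. (SUP i. U i x) \<partial>\<rho>) = (SUP i. integral\<^sup>N \<rho> (U i))" if "\<rho> \<in> ?S" for \<rho>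
      by (rule nn_integral_monotone_convergence_SUP[OF seq(3) meas[OF seq(1) that]])
    then show ?case by (simp add: seq.IH ennreal_SUP_add[OF mono mono] del: Sup_apply)
  qed
qed

lemma
  assumes M: "\<mu> \<in> finite_borel_measures" "\<nu> \<in> finite_borel_measures"
  shows finite_borel_measures_add: "add_measure \<mu> \<nu> \<in> finite_borel_measures"
    and measure_add_measure: "measure (add_measure \<mu> \<nu>) A = measure \<mu> A + measure \<nu> A"
proof -
  note [simp] = finite_borel_measuresD[OF M(1)] finite_borel_measuresD[OF M(2)]
  interpret \<mu>: finite_measure \<mu> by simp
  interpret \<nu>: finite_measure \<nu> by simp
  have em: "emeasure (add_measure \<mu> \<nu>) A = ennreal (measure \<mu> A + measure \<nu> A)" for A
    by (simp add: emeasure_add_measure \<mu>.emeasure_eq_measure \<nu>.emeasure_eq_measure ennreal_plus)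
  show "add_measure \<mu> \<nu> \<in> finite_borel_measures"
    by (auto simp: finite_borel_measures_def em intro!: finite_measureI)
  show "measure (add_measure \<mu> \<nu>) A = measure \<mu> A + measure \<nu> A"
    by (rule measure_eq_emeasure_eq_ennreal) (simp_all add: em)
qed

lemma scale_finite_borel_measures:
  assumes "\<mu> \<in> finite_borel_measures"
  shows "scale_measure (ennreal c) \<mu> \<in> finite_borel_measures"
proof -
  interpret finite_measure \<mu> using finite_borel_measuresD[OF assms] by simp
  show ?thesis
    using finite_borel_measuresD[OF assms] 
    by (auto simp: finite_borel_measures_def space_scale_measure ennreal_mult_eq_top_iff intro!: finite_measureI)
qed

section \<open>Unnormalised transport plans\<close>

text \<open>Passing a bound to the infimum. The factor must be positive because \<open>0 * top = 0\<close> in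
\<^typ>\<open>ennreal\<close>, while the infimum over an empty set is \<open>top\<close>.\<close>

lemma ennreal_le_add_mult_INF:
  fixes k t x :: ennreal
  assumes k: "0 < k" "k < top" and le: "\<And>i. i \<in> I \<Longrightarrow> x \<le> t + k * f i"
  shows "x \<le> t + k * (INF i\<in>I. f i)"
proof (cases "t = top")
  case False
  have "(x - t) / k \<le> f i" if "i \<in> I" for i
    using le[OF that] k False
    by (intro divide_le_posI_ennreal) (auto simp: ennreal_minus_le_iff mult.commute)
  then have "(x - t) / k \<le> (INF i\<in>I. f i)" by (rule INF_greatest)
  then have "(x - t) / k * k \<le> (INF i\<in>I. f i) * k" by (rule mult_right_mono) simp
  moreover have "(x - t) / k * k = x - t"
    using k by (intro ennreal_divide_times[THEN trans] ) (auto simp: ennreal_mult_divide_eq mult.commute)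
  ultimately show ?thesis using False by (simp add: ennreal_minus_le_iff mult.commute)
qed simp

definition transport_cost :: "('a::metric_space \<times> 'a) measure \<Rightarrow> ennreal" where
  "transport_cost \<pi> = (\<integral>\<^sup>+z. ennreal (dist (fst z) (snd z)) \<partial>\<pi>)"

text \<open>A finite measure \<open>\<pi>\<close> on pairs serves as an unnormalised transport plan: it carries its own mass and
determines the two measures that it transports, its marginals. The cost of \<open>\<pi>\<close> charges \<open>a\<close> for
every unit of mass by which the marginals miss \<open>\<mu>\<close> and \<open>\<nu>\<close>.\<close>

definition plan_cost ::
    "real \<Rightarrow> real \<Rightarrow> 'a::metric_space measure \<Rightarrow> 'a measure \<Rightarrow> ('a \<times> 'a) measure \<Rightarrow> ennreal" where
  "plan_cost a b \<mu> \<nu> \<pi> =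
    ennreal a * tv_dist \<mu> (distr \<pi> borel fst) + ennreal a * tv_dist \<nu> (distr \<pi> borel snd)
    + ennreal b * transport_cost \<pi>"

text \<open>One infimum in place of the two nested ones of \<^const>\<open>gen_wasserstein1\<close>. There is no moment
condition on the marginals and no constraint of equal masses, so that plans may freely be scaled,
added and restricted.\<close>

definition unbalanced_cost :: "real \<Rightarrow> real \<Rightarrow> 'a::metric_space measure \<Rightarrow> 'a measure \<Rightarrow> ennreal" where
  "unbalanced_cost a b \<mu> \<nu> = (INF \<pi>\<in>finite_borel_measures. plan_cost a b \<mu> \<nu> \<pi>)"

lemma unbalanced_cost_le_plan_cost:
  assumes "\<pi> \<in> finite_borel_measures"
  shows "unbalanced_cost a b \<mu> \<nu> \<le> plan_cost a b \<mu> \<nu> \<pi>"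
  unfolding unbalanced_cost_def by (rule INF_lower[OF assms])

lemma measurable_on_borel_pairs:
  assumes "sets (\<pi> :: ('a::metric_space \<times> 'a) measure) = sets borel"
  shows "fst \<in> \<pi> \<rightarrow>\<^sub>M borel" and "snd \<in> \<pi> \<rightarrow>\<^sub>M borel" and "(\<lambda>z. (snd z, fst z)) \<in> \<pi> \<rightarrow>\<^sub>M borel"
    and "(\<lambda>z. ennreal (dist (fst z) (snd z))) \<in> borel_measurable \<pi>"
proof -
  have "(\<lambda>z :: 'a \<times> 'a. (snd z, fst z)) \<in> borel_measurable borel"
    by (intro borel_measurable_continuous_onI continuous_intros)
  moreover have "(\<lambda>z :: 'a \<times> 'a. dist (fst z) (snd z)) \<in> borel_measurable borel"
    by (intro borel_measurable_continuous_onI continuous_intros)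
  moreover have "(fst :: 'a \<times> 'a \<Rightarrow> _) \<in> borel_measurable borel" "(snd :: 'a \<times> 'a \<Rightarrow> _) \<in> borel_measurable borel"
    by (intro borel_measurable_continuous_onI continuous_intros)+
  ultimately show "fst \<in> \<pi> \<rightarrow>\<^sub>M borel" "snd \<in> \<pi> \<rightarrow>\<^sub>M borel" "(\<lambda>z. (snd z, fst z)) \<in> \<pi> \<rightarrow>\<^sub>M borel"
    "(\<lambda>z. ennreal (dist (fst z) (snd z))) \<in> borel_measurable \<pi>"
    by (simp_all add: assms cong: measurable_cong_sets)
qed

lemma finite_borel_measures_distr:
  assumes "\<pi> \<in> finite_borel_measures" "f \<in> \<pi> \<rightarrow>\<^sub>M borel"
  shows "distr \<pi> borel f \<in> finite_borel_measures"
proof -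
  interpret finite_measure \<pi> using finite_borel_measuresD[OF assms(1)] by simp
  show ?thesis by (auto simp: finite_borel_measures_def intro: finite_measure_distr assms(2))
qed

lemma marginals:
  fixes \<pi> :: "('a::metric_space \<times> 'a) measure"
  assumes "\<pi> \<in> finite_borel_measures"
  shows "distr \<pi> borel fst \<in> finite_borel_measures" "distr \<pi> borel snd \<in> finite_borel_measures"
    "\<And>A. A \<in> sets borel \<Longrightarrow> emeasure (distr \<pi> borel fst) A = emeasure \<pi> (A \<times> UNIV)"
    "\<And>A. A \<in> sets borel \<Longrightarrow> emeasure (distr \<pi> borel snd) A = emeasure \<pi> (UNIV \<times> A)"
    "measure (distr \<pi> borel fst) UNIV = measure \<pi> UNIV" "measure (distr \<pi> borel snd) UNIV = measure \<pi> UNIV"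
proof -
  note [simp] = finite_borel_measuresD[OF assms]
  note [measurable] = measurable_on_borel_pairs[of \<pi>, simplified]
  show "distr \<pi> borel fst \<in> finite_borel_measures" "distr \<pi> borel snd \<in> finite_borel_measures"
    by (intro finite_borel_measures_distr assms; measurable)+
  show 1: "emeasure (distr \<pi> borel fst) A = emeasure \<pi> (A \<times> UNIV)"
   "emeasure (distr \<pi> borel snd) A = emeasure \<pi> (UNIV \<times> A)" if "A \<in> sets borel" for A
    using that by (auto simp: emeasure_distr intro!: arg_cong[of _ _ "emeasure \<pi>"])
  show "measure (distr \<pi> borel fst) UNIV = measure \<pi> UNIV" "measure (distr \<pi> borel snd) UNIV = measure \<pi> UNIV"
    by (simp_all add: measure_distr)
qed

text \<open>Removing mass from an approximation \<open>\<mu>'\<close> of \<open>\<mu>\<close> costs at most the mass removed.\<close>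

lemma tv_dist_shrink:
  assumes "\<mu>' \<in> finite_borel_measures" "\<mu>'' \<in> finite_borel_measures"
    and "\<And>A. A \<in> sets borel \<Longrightarrow> emeasure \<mu>'' A \<le> emeasure \<mu>' A"
  shows "tv_dist \<mu> \<mu>'' \<le> tv_dist \<mu> \<mu>' + ennreal (measure \<mu>' UNIV - measure \<mu>'' UNIV)"
proof -
  interpret finite_measure \<mu>' using finite_borel_measuresD[OF assms(1)] by simp
  have "tv_dist \<mu>' \<mu>'' \<le> ennreal (measure \<mu>' UNIV - measure \<mu>'' UNIV)"
    by (rule tv_dist_le_mass_diff[OF assms(1,2)])
      (auto simp: measure_def intro!: enn2real_mono assms(3) simp: less_top[symmetric])
  then show ?thesis using tv_dist_triangle[of \<mu> \<mu>'' \<mu>'] by (meson add_left_mono order_trans)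
qed

text \<open>A probability plan between \<open>\<mu>'\<close> and \<open>\<nu>'\<close> becomes an unnormalised plan with exactly these marginals
when it is multiplied by their common mass. For mass zero the factor in front of the infimum
hides the plans, and the zero plan takes their place.\<close>

lemma unbalanced_cost_le_gen:
  fixes \<mu>' \<nu>' :: "'a::polish_space measure"
  assumes b: "b > 0"
    and M: "\<mu>' \<in> finite_borel_measures" "\<nu>' \<in> finite_borel_measures"
    and mass: "emeasure \<mu>' UNIV = emeasure \<nu>' UNIV"
  shows "unbalanced_cost a b \<mu> \<nu>
    \<le> ennreal a * tv_dist \<mu> \<mu>' + ennreal a * tv_dist \<nu> \<nu>' + ennreal b * wasserstein1 \<mu>' \<nu>'"
proof -
  define m where "m = emeasure \<mu>' UNIV"
  define T where "T = ennreal a * tv_dist \<mu> \<mu>' + ennreal a * tv_dist \<nu> \<nu>'"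
  note [simp] = finite_borel_measuresD[OF M(1)] finite_borel_measuresD[OF M(2)]
  have m: "m < top"
    using finite_measure.emeasure_finite[of \<mu>' UNIV] by (simp add: m_def less_top)
  have plan: "unbalanced_cost a b \<mu> \<nu> \<le> T + ennreal b * (m * transport_cost \<pi>)"
    if s: "sets \<pi> = sets borel" "finite_measure \<pi>"
      and "\<And>A. A \<in> sets borel \<Longrightarrow> m * emeasure \<pi> (A \<times> UNIV) = emeasure \<mu>' A"
      and "\<And>A. A \<in> sets borel \<Longrightarrow> m * emeasure \<pi> (UNIV \<times> A) = emeasure \<nu>' A" for \<pi>
  proof -
    let ?p = "scale_measure m \<pi>"
    have p: "?p \<in> finite_borel_measures"
      using s m finite_measure.emeasure_finite[OF s(2), of "space \<pi>"]
      by (auto simp: finite_borel_measures_def ennreal_mult_eq_top_iff space_scale_measure intro!: finite_measureI)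
    have "distr ?p borel fst = \<mu>'" "distr ?p borel snd = \<nu>'"
      using marginals(3,4)[OF p] that by (auto intro!: measure_eqI)
    then have "plan_cost a b \<mu> \<nu> ?p = T + ennreal b * (m * transport_cost \<pi>)"
      using measurable_on_borel_pairs(4)[OF s(1)]
      by (simp add: plan_cost_def T_def transport_cost_def nn_integral_scale_measure)
    then show ?thesis using unbalanced_cost_le_plan_cost[OF p, of a b \<mu> \<nu>] by simp
  qed
  have "unbalanced_cost a b \<mu> \<nu> \<le> T + ennreal b * wasserstein1 \<mu>' \<nu>'"
  proof (cases "m = 0")
    case True
    have "emeasure \<mu>' A = 0" "emeasure \<nu>' A = 0" for A
      using True emeasure_space[of \<mu>' A] emeasure_space[of \<nu>' A] mass by (auto simp: m_def)
    then show ?thesis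
      using plan[of "null_measure borel"] True
      by (simp add: wasserstein1_def m_def finite_measureI)
  next
    case False
    have "unbalanced_cost a b \<mu> \<nu> \<le> T + (ennreal b * m) * (INF \<pi>\<in>transport_plans \<mu>' \<nu>'. transport_cost \<pi>)"
    proof (rule ennreal_le_add_mult_INF)
      show "0 < ennreal b * m" "ennreal b * m < top"
        using b m False by (auto simp: ennreal_mult_less_top ennreal_zero_less_mult_iff zero_less_iff_neq_zero)
      show "unbalanced_cost a b \<mu> \<nu> \<le> T + ennreal b * m * transport_cost \<pi>"
        if "\<pi> \<in> transport_plans \<mu>' \<nu>'" for \<pi>
        using plan[of \<pi>] that prob_space.finite_measure[of \<pi>]
        by (auto simp: transport_plans_def m_def mult.assoc mass)
    qed
    then show ?thesis by (simp add: wasserstein1_def m_def mult.assoc transport_cost_def)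
  qed
  then show ?thesis by (simp add: T_def)
qed

lemma wasserstein1_marginals_le:
  fixes \<pi> :: "('a::polish_space \<times> 'a) measure"
  assumes "\<pi> \<in> finite_borel_measures"
  shows "wasserstein1 (distr \<pi> borel fst) (distr \<pi> borel snd) \<le> transport_cost \<pi>"
proof -
  note [simp] = finite_borel_measuresD[OF assms]
  interpret finite_measure \<pi> by simp
  let ?m = "emeasure \<pi> UNIV"
  have m: "emeasure (distr \<pi> borel fst) UNIV = ?m" "emeasure (distr \<pi> borel snd) UNIV = ?m"
    using marginals(3,4)[OF assms, of UNIV] by simp_all
  show ?thesis
  proof (cases "?m = 0")
    case False
    have fin: "?m \<noteq> top" by (simp add: emeasure_finite)
    have unit: "?m * (inverse ?m * x) = x" for x
      using False fin by (metis ennreal_inverse_mult mult.assoc mult.commute mult_1 top.not_eq_extremum zero_less_iff_neq_zero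
          ennreal_mult_divide_eq divide_ennreal_def)
    let ?p = "scale_measure (inverse ?m) \<pi>"
    have "?p \<in> transport_plans (distr \<pi> borel fst) (distr \<pi> borel snd)"
      using unit[of 1] unit marginals(3,4)[OF assms] m
      by (auto simp: transport_plans_def space_scale_measure mult.commute[of "inverse ?m" ?m] intro!: prob_spaceI)
    then have "(INF \<pi>\<in>transport_plans (distr \<pi> borel fst) (distr \<pi> borel snd). transport_cost \<pi>) \<le> transport_cost ?p"
      by (rule INF_lower)
    also have "transport_cost ?p = inverse ?m * transport_cost \<pi>"
      using measurable_on_borel_pairs(4)[of \<pi>] by (simp add: transport_cost_def nn_integral_scale_measure)
    finally have "wasserstein1 (distr \<pi> borel fst) (distr \<pi> borel snd) \<le> ?m * (inverse ?m * transport_cost \<pi>)"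
      unfolding wasserstein1_def m transport_cost_def by (intro mult_left_mono) auto
    then show ?thesis by (simp add: unit)
  qed (simp add: wasserstein1_def m)
qed

lemma bounded_distance_finite_borel_measures1:
  assumes "\<mu> \<in> finite_borel_measures" "AE x in \<mu>. dist x x\<^sub>0 \<le> r"
  shows "\<mu> \<in> finite_borel_measures1"
proof -
  interpret finite_measure \<mu> using finite_borel_measuresD[OF assms(1)] by simp
  have "(\<integral>\<^sup>+x. ennreal (dist x x\<^sub>0) \<partial>\<mu>) \<le> (\<integral>\<^sup>+x. ennreal r \<partial>\<mu>)"
    using assms(2) by (intro nn_integral_mono_AE) (auto intro: ennreal_leI)
  also have "\<dots> < top"
    by (simp add: ennreal_mult_eq_top_iff less_top[symmetric])
  finally show ?thesis using assms(1) by (auto simp: finite_borel_measures1_def)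
qed

text \<open>The marginals of an arbitrary plan need not have a finite first moment. Restricting the plan to
the pairs in which both points have distance at most \<open>n\<close> from a fixed point produces marginals of
bounded support and does not raise the transport cost. The mass lost tends to \<open>0\<close> as \<open>n\<close> grows, and it enters
the cost twice with the factor \<open>a\<close>, once per marginal.\<close>

lemma gen_le_unbalanced_cost:
  fixes \<mu> \<nu> :: "'a::polish_space measure"
  assumes a: "a > 0" and \<pi>: "\<pi> \<in> finite_borel_measures"
  shows "(INF (\<mu>', \<nu>') \<in> {(\<mu>', \<nu>'). \<mu>' \<in> finite_borel_measures1 \<and> \<nu>' \<in> finite_borel_measures1 \<and>
                           emeasure \<mu>' UNIV = emeasure \<nu>' UNIV}.
      ennreal a * tv_dist \<mu> \<mu>' + ennreal a * tv_dist \<nu> \<nu>' + ennreal b * wasserstein1 \<mu>' \<nu>')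
    \<le> plan_cost a b \<mu> \<nu> \<pi>" (is "?L \<le> _")
proof (rule ennreal_le_epsilon)
  fix e :: real
  assume e: "e > 0"
  note [simp] = finite_borel_measuresD[OF \<pi>]
  note [measurable] = measurable_on_borel_pairs[of \<pi>, simplified]
  interpret finite_measure \<pi> by simp
  fix x\<^sub>0 :: 'a
  define B where "B n = {z. dist (fst z) x\<^sub>0 \<le> real n \<and> dist (snd z) x\<^sub>0 \<le> real n}" for n
  have B_meas: "B n \<in> sets \<pi>" for n
  proof -
    have "{z \<in> space \<pi>. dist (fst z) x\<^sub>0 \<le> real n \<and> dist (snd z) x\<^sub>0 \<le> real n} \<in> sets \<pi>" by measurable
    then show ?thesis by (simp add: B_def)
  qed
  have UN: "(\<Union>n. B n) = UNIV"
  proof -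
    have "\<exists>n. z \<in> B n" for z
    proof -
      obtain n where "max (dist (fst z) x\<^sub>0) (dist (snd z) x\<^sub>0) \<le> real n" using real_arch_simple by blast
      then show ?thesis by (auto simp: B_def)
    qed
    then show ?thesis by auto
  qed
  have "(\<lambda>n. measure \<pi> (B n)) \<longlonglongrightarrow> measure \<pi> (\<Union>n. B n)"
    using B_meas by (intro finite_Lim_measure_incseq) (auto simp: incseq_def B_def)
  then have "\<forall>\<^sub>F n in sequentially. measure \<pi> (B n) > measure \<pi> UNIV - e / (2 * a)"
    using e a by (intro order_tendstoD(1)[of _ "measure \<pi> UNIV"]) (auto simp: UN)
  then obtain n where n: "measure \<pi> UNIV - measure \<pi> (B n) < e / (2 * a)"
    by (auto simp: eventually_sequentially algebra_simps)
  define \<rho> where "\<rho> = density \<pi> (indicator (B n))"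
  have ind [measurable]: "indicator (B n) \<in> borel_measurable \<pi>"
    by (intro borel_measurable_indicator B_meas)
  have \<rho>: "\<rho> \<in> finite_borel_measures"
    using B_meas by (auto simp: \<rho>_def finite_borel_measures_def emeasure_restricted intro!: finite_measureI)
  have em: "emeasure \<rho> A = emeasure \<pi> (B n \<inter> A)" if "A \<in> sets borel" for A
    using that B_meas by (simp add: \<rho>_def emeasure_restricted)
  have mass: "measure \<rho> UNIV = measure \<pi> (B n)"
    using em[of UNIV] by (simp add: measure_def)
  have sub: "emeasure \<rho> A \<le> emeasure \<pi> A" for A
    using em B_meas by (cases "A \<in> sets borel") (auto simp: emeasure_notin_sets finite_borel_measuresD[OF \<rho>] intro!: emeasure_mono)
  have AE: "AE z in \<rho>. z \<in> B n"
  proof -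
    from ind show ?thesis unfolding \<rho>_def by (subst AE_density) (auto simp: indicator_def)
  qed
  have M1: "distr \<rho> borel fst \<in> finite_borel_measures1" "distr \<rho> borel snd \<in> finite_borel_measures1"
    using AE measurable_on_borel_pairs[of \<rho>] finite_borel_measuresD[OF \<rho>]
    by (auto intro!: bounded_distance_finite_borel_measures1[of _ x\<^sub>0 n] marginals[OF \<rho>] AE_distr_iff[THEN iffD2]
      simp: B_def)
  have tv: "tv_dist \<mu> (distr \<rho> borel fst) \<le> tv_dist \<mu> (distr \<pi> borel fst) + ennreal (e / (2 * a))"
    "tv_dist \<nu> (distr \<rho> borel snd) \<le> tv_dist \<nu> (distr \<pi> borel snd) + ennreal (e / (2 * a))"
  proof -
    have small: "ennreal (measure \<pi> UNIV - measure \<rho> UNIV) \<le> ennreal (e / (2 * a))"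
      using n by (intro ennreal_leI) (simp add: mass)
    have sub': "emeasure (distr \<rho> borel fst) A \<le> emeasure (distr \<pi> borel fst) A"
      "emeasure (distr \<rho> borel snd) A \<le> emeasure (distr \<pi> borel snd) A" if "A \<in> sets borel" for A
      using sub by (simp_all only: marginals(3,4)[OF \<rho> that] marginals(3,4)[OF \<pi> that])
    show "tv_dist \<mu> (distr \<rho> borel fst) \<le> tv_dist \<mu> (distr \<pi> borel fst) + ennreal (e / (2 * a))"
      using tv_dist_shrink[OF marginals(1)[OF \<pi>] marginals(1)[OF \<rho>] sub'(1), of \<mu>]
        add_left_mono[OF small, of "tv_dist \<mu> (distr \<pi> borel fst)"]
      unfolding marginals(5)[OF \<rho>] marginals(5)[OF \<pi>] by (rule order_trans)
    show "tv_dist \<nu> (distr \<rho> borel snd) \<le> tv_dist \<nu> (distr \<pi> borel snd) + ennreal (e / (2 * a))"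
      using tv_dist_shrink[OF marginals(2)[OF \<pi>] marginals(2)[OF \<rho>] sub'(2), of \<nu>]
        add_left_mono[OF small, of "tv_dist \<nu> (distr \<pi> borel snd)"]
      unfolding marginals(6)[OF \<rho>] marginals(6)[OF \<pi>] by (rule order_trans)
  qed
  have cost: "wasserstein1 (distr \<rho> borel fst) (distr \<rho> borel snd) \<le> transport_cost \<pi>"
  proof -
    have "transport_cost \<rho> = (\<integral>\<^sup>+z. indicator (B n) z * ennreal (dist (fst z) (snd z)) \<partial>\<pi>)"
      unfolding transport_cost_def \<rho>_def by (rule nn_integral_density) measurable
    also have "\<dots> \<le> transport_cost \<pi>"
      unfolding transport_cost_def by (intro nn_integral_mono) (auto simp: indicator_def)
    finally show ?thesis using wasserstein1_marginals_le[OF \<rho>] by simp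
  qed
  have "?L \<le> ennreal a * tv_dist \<mu> (distr \<rho> borel fst) + ennreal a * tv_dist \<nu> (distr \<rho> borel snd)
      + ennreal b * wasserstein1 (distr \<rho> borel fst) (distr \<rho> borel snd)"
    using M1 marginals(3,4)[OF \<rho>, of UNIV]
    by (intro INF_lower2[of "(distr \<rho> borel fst, distr \<rho> borel snd)"]) auto
  also have "\<dots> \<le> ennreal a * (tv_dist \<mu> (distr \<pi> borel fst) + ennreal (e / (2 * a)))
      + ennreal a * (tv_dist \<nu> (distr \<pi> borel snd) + ennreal (e / (2 * a))) + ennreal b * transport_cost \<pi>"
    by (intro add_mono mult_left_mono tv cost) auto
  also have "\<dots> = plan_cost a b \<mu> \<nu> \<pi> + (ennreal a * ennreal (e / (2 * a)) + ennreal a * ennreal (e / (2 * a)))"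
    by (simp add: plan_cost_def distrib_left ac_simps)
  also have "ennreal a * ennreal (e / (2 * a)) + ennreal a * ennreal (e / (2 * a)) = ennreal e"
    using a e by (simp flip: ennreal_mult ennreal_plus)
  finally show "?L \<le> plan_cost a b \<mu> \<nu> \<pi> + ennreal e" .
qed

theorem gen_wasserstein1_eq_unbalanced_cost:
  fixes \<mu> \<nu> :: "'a::polish_space measure"
  assumes "a > 0" "b > 0"
  shows "gen_wasserstein1 a b \<mu> \<nu> = enn2real (unbalanced_cost a b \<mu> \<nu>)"
  unfolding gen_wasserstein1_def
proof (intro arg_cong[of _ _ enn2real] antisym, goal_cases)
  case 1
  show ?case unfolding unbalanced_cost_def
    by (intro INF_greatest gen_le_unbalanced_cost assms)
next
  case 2
  show ?case
    by (intro INF_greatest)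
      (auto intro!: unbalanced_cost_le_gen assms simp: finite_borel_measures1_def)
qed

section \<open>Gluing and the triangle inequality\<close>

text \<open>The level sets of \<open>k\<close> are a countable Borel partition into cells of diameter below \<open>e\<close>: a point gets
the index of the first member of a countable dense set that is closer than \<open>e / 2\<close>.\<close>

lemma small_cells:
  assumes "e > 0"
  obtains k :: "'a::{metric_space, second_countable_topology} \<Rightarrow> nat"
  where "k \<in> borel \<rightarrow>\<^sub>M count_space UNIV" and "\<And>x y. k x = k y \<Longrightarrow> dist x y < e"
proof -
  obtain D :: "'a set" where D: "countable D" "\<And>X. open X \<Longrightarrow> X \<noteq> {} \<Longrightarrow> \<exists>d\<in>D. d \<in> X"
    using countable_dense_setE by blast
  define k where "k x = (LEAST n. dist x (from_nat_into D n) < e / 2)" for x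
  have near: "dist x (from_nat_into D (k x)) < e / 2" for x
  proof -
    obtain d where "d \<in> D" "dist x d < e / 2"
      using D(2)[of "ball x (e / 2)"] assms by auto
    moreover obtain n where "from_nat_into D n = d"
      using from_nat_into_surj[OF D(1) \<open>d \<in> D\<close>] by blast
    ultimately have "\<exists>n. dist x (from_nat_into D n) < e / 2" by blast
    then show ?thesis unfolding k_def by (rule LeastI_ex)
  qed
  show thesis
  proof
    show "k \<in> borel \<rightarrow>\<^sub>M count_space UNIV" unfolding k_def by measurable
    show "dist x y < e" if "k x = k y" for x y
      using near[of x] near[of y] that dist_triangle_half_r[of "from_nat_into D (k x)" x e y]
      by (simp add: dist_commute)
  qed
qed

lemma nn_integral_nat_valued:
  fixes g :: "nat \<Rightarrow> ennreal"
  assumes [measurable]: "k \<in> M \<rightarrow>\<^sub>M count_space UNIV"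
  shows "(\<integral>\<^sup>+x. g (k x) \<partial>M) = (\<Sum>i. g i * emeasure M {x \<in> space M. k x = i})"
proof -
  have "g (k x) = (\<Sum>i. g i * indicator {x \<in> space M. k x = i} x)" if "x \<in> space M" for x
    using that suminf_finite[of "{k x}" "\<lambda>i. g i * indicator {x \<in> space M. k x = i} x"] by simp
  then have "(\<integral>\<^sup>+x. g (k x) \<partial>M) = (\<integral>\<^sup>+x. (\<Sum>i. g i * indicator {x \<in> space M. k x = i} x) \<partial>M)"
    by (rule nn_integral_cong)
  also have "\<dots> = (\<Sum>i. \<integral>\<^sup>+x. g i * indicator {x \<in> space M. k x = i} x \<partial>M)"
    by (rule nn_integral_suminf) measurable
  also have "\<dots> = (\<Sum>i. g i * emeasure M {x \<in> space M. k x = i})"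
    by (intro suminf_cong nn_integral_cmult_indicator) measurable
  finally show ?thesis .
qed

text \<open>Exact gluing of two plans needs a common middle marginal and a disintegration along it. Up to an
error \<open>e\<close> per unit of mass, a discrete construction does the same. Partition the middle space into small cells, and in
the cell with index \<open>i\<close> let \<open>p i\<close> be the mass that \<open>\<pi>1\<close> brings in and \<open>q i\<close> the mass that \<open>\<pi>2\<close> takes out.
Within the cell, connect every incoming \<open>(x, y)\<close> with every outgoing \<open>(y', z)\<close> independently, in total
mass \<open>min (p i) (q i)\<close>. Only this step jumps from \<open>y\<close> to \<open>y'\<close>, which are closer than \<open>e\<close>, so that the
cost of the glued plan exceeds the sum of both costs by at most \<open>e\<close> times its mass.

The glued marginals lie below the outer marginals of \<open>\<pi>1\<close> and \<open>\<pi>2\<close>. The masses that are lost add up to the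
sum over the cells of \<open>\<bar>p i - q i\<bar>\<close>, which the distance in total variation of the two middle
marginals controls.\<close>

lemma approximate_gluing:
  fixes \<pi>1 \<pi>2 :: "('a::polish_space \<times> 'a) measure"
  assumes M: "\<pi>1 \<in> finite_borel_measures" "\<pi>2 \<in> finite_borel_measures" and e: "e > 0"
  obtains \<pi> where "\<pi> \<in> finite_borel_measures"
    and "\<And>A. A \<in> sets borel \<Longrightarrow> emeasure (distr \<pi> borel fst) A \<le> emeasure (distr \<pi>1 borel fst) A"
    and "\<And>A. A \<in> sets borel \<Longrightarrow> emeasure (distr \<pi> borel snd) A \<le> emeasure (distr \<pi>2 borel snd) A"
    and "ennreal (measure \<pi>1 UNIV - measure \<pi> UNIV) + ennreal (measure \<pi>2 UNIV - measure \<pi> UNIV)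
      \<le> tv_dist (distr \<pi>1 borel snd) (distr \<pi>2 borel fst)"
    and "transport_cost \<pi> \<le> transport_cost \<pi>1 + transport_cost \<pi>2 + ennreal e * emeasure \<pi>1 UNIV"
proof -
  note [simp] = finite_borel_measuresD[OF M(1)] finite_borel_measuresD[OF M(2)]
  interpret M1: finite_measure \<pi>1 by simp
  interpret M2: finite_measure \<pi>2 by simp
  interpret P: pair_sigma_finite \<pi>1 \<pi>2 ..
  obtain k :: "'a \<Rightarrow> nat" where k: "k \<in> borel \<rightarrow>\<^sub>M count_space UNIV" "\<And>x y. k x = k y \<Longrightarrow> dist x y < e"
    using small_cells[OF e] by blast
  note [measurable] = measurable_on_borel_pairs[of \<pi>1, simplified] measurable_on_borel_pairs[of \<pi>2, simplified] k(1)
  define p where "p i = measure \<pi>1 {z. k (snd z) = i}" for i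
  define q where "q i = measure \<pi>2 {z. k (fst z) = i}" for i
  \<comment> \<open>The product of both plans on the cell \<open>i\<close> has mass \<open>p i * q i\<close>, and \<open>c i\<close> rescales it to
    mass \<open>min (p i) (q i)\<close>. If the product vanishes, then \<open>c i = 0\<close> and both masses are \<open>0\<close>.\<close>
  define c where "c i = min (p i) (q i) / (p i * q i)" for i
  define w where "w u = (if k (snd (fst u)) = k (fst (snd u)) then ennreal (c (k (snd (fst u)))) else 0)" for u :: "('a \<times> 'a) \<times> ('a \<times> 'a)"
  have coords [measurable]:
    "(\<lambda>u. fst (fst u)) \<in> \<pi>1 \<Otimes>\<^sub>M \<pi>2 \<rightarrow>\<^sub>M borel" "(\<lambda>u. snd (fst u)) \<in> \<pi>1 \<Otimes>\<^sub>M \<pi>2 \<rightarrow>\<^sub>M borel"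
    "(\<lambda>u. fst (snd u)) \<in> \<pi>1 \<Otimes>\<^sub>M \<pi>2 \<rightarrow>\<^sub>M borel" "(\<lambda>u. snd (snd u)) \<in> \<pi>1 \<Otimes>\<^sub>M \<pi>2 \<rightarrow>\<^sub>M borel"
    by (rule measurable_compose[OF measurable_fst] measurable_compose[OF measurable_snd];
        rule measurable_on_borel_pairs; simp)+
  have w_meas [measurable]: "w \<in> borel_measurable (\<pi>1 \<Otimes>\<^sub>M \<pi>2)"
  proof -
    have "(\<lambda>u. if K u = L u then ennreal (c (K u)) else 0) \<in> borel_measurable (\<pi>1 \<Otimes>\<^sub>M \<pi>2)"
      if [measurable]: "K \<in> \<pi>1 \<Otimes>\<^sub>M \<pi>2 \<rightarrow>\<^sub>M count_space UNIV" "L \<in> \<pi>1 \<Otimes>\<^sub>M \<pi>2 \<rightarrow>\<^sub>M count_space UNIV"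
      for K L :: "_ \<Rightarrow> nat"
    proof (rule measurable_If)
      show "(\<lambda>u. ennreal (c (K u))) \<in> borel_measurable (\<pi>1 \<Otimes>\<^sub>M \<pi>2)"
        by (rule measurable_compose[OF that(1)]) simp
    next
      have [measurable]: "(\<lambda>u. real (K u)) \<in> borel_measurable (\<pi>1 \<Otimes>\<^sub>M \<pi>2)" "(\<lambda>u. real (L u)) \<in> borel_measurable (\<pi>1 \<Otimes>\<^sub>M \<pi>2)"
        by (rule measurable_compose[OF that(1)] measurable_compose[OF that(2)]; simp)+
      have "{u \<in> space (\<pi>1 \<Otimes>\<^sub>M \<pi>2). real (K u) = real (L u)} \<in> sets (\<pi>1 \<Otimes>\<^sub>M \<pi>2)" by measurable
      then show "{u \<in> space (\<pi>1 \<Otimes>\<^sub>M \<pi>2). K u = L u} \<in> sets (\<pi>1 \<Otimes>\<^sub>M \<pi>2)" by simp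
    qed simp
    from this[OF measurable_compose[OF coords(2) k(1)] measurable_compose[OF coords(3) k(1)]]
    show ?thesis by (simp add: w_def[abs_def])
  qed
  have em_p: "emeasure \<pi>1 {z. k (snd z) = i} = ennreal (p i)" and em_q: "emeasure \<pi>2 {z. k (fst z) = i} = ennreal (q i)" for i
    by (simp_all add: p_def q_def M1.emeasure_eq_measure M2.emeasure_eq_measure)
  have [simp]: "0 \<le> p i" "0 \<le> q i" "0 \<le> c i" for i
    by (simp_all add: p_def q_def c_def)
  have cq: "c i * q i \<le> 1" and cp: "c i * p i \<le> 1" and cqp: "c i * q i * p i = min (p i) (q i)" for i
  proof -
    have "min x y / (x * y) * y \<le> 1 \<and> min x y / (x * y) * x \<le> 1 \<and> min x y / (x * y) * y * x = min x y"
      if "0 \<le> x" "0 \<le> y" for x y :: real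
      using that by (cases "x = 0"; cases "y = 0") (auto simp: divide_simps min_def)
    from this[of "p i" "q i"] show "c i * q i \<le> 1" "c i * p i \<le> 1" "c i * q i * p i = min (p i) (q i)"
      by (simp_all add: c_def)
  qed
  define Q where "Q = density (\<pi>1 \<Otimes>\<^sub>M \<pi>2) w"
  \<comment> \<open>The measure \<open>Q\<close> lives on quadruples \<open>((x, y), (y', z))\<close>, and \<open>J\<close> forgets the middle points.\<close>
  define J where "J u = (fst (fst u), snd (snd u))" for u :: "('a \<times> 'a) \<times> ('a \<times> 'a)"
  have [measurable]: "J \<in> \<pi>1 \<Otimes>\<^sub>M \<pi>2 \<rightarrow>\<^sub>M borel"
    unfolding J_def borel_prod[symmetric] by measurable
  have setsQ [measurable_cong]: "sets Q = sets (\<pi>1 \<Otimes>\<^sub>M \<pi>2)" by (simp add: Q_def)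
  define \<pi> where "\<pi> = distr Q borel J"
  have w1: "(\<integral>\<^sup>+z2. w (z1, z2) \<partial>\<pi>2) = ennreal (c (k (snd z1)) * q (k (snd z1)))" for z1
  proof -
    have "{z. k (fst z) = k (snd z1)} = {z \<in> space \<pi>2. k (fst z) = k (snd z1)}" by simp
    also have "\<dots> \<in> sets \<pi>2" by measurable
    finally have 1: "{z. k (fst z) = k (snd z1)} \<in> sets \<pi>2" .
    have "(\<integral>\<^sup>+z2. w (z1, z2) \<partial>\<pi>2) = (\<integral>\<^sup>+z2. ennreal (c (k (snd z1))) * indicator {z. k (fst z) = k (snd z1)} z2 \<partial>\<pi>2)"
      by (intro nn_integral_cong) (auto simp: w_def)
    also have "\<dots> = ennreal (c (k (snd z1))) * ennreal (q (k (snd z1)))"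
      unfolding nn_integral_cmult_indicator[OF 1] em_q ..
    finally show ?thesis by (simp add: ennreal_mult)
  qed
  have w2: "(\<integral>\<^sup>+z1. w (z1, z2) \<partial>\<pi>1) = ennreal (c (k (fst z2)) * p (k (fst z2)))" for z2
  proof -
    have "{z. k (snd z) = k (fst z2)} = {z \<in> space \<pi>1. k (snd z) = k (fst z2)}" by simp
    also have "\<dots> \<in> sets \<pi>1" by measurable
    finally have 1: "{z. k (snd z) = k (fst z2)} \<in> sets \<pi>1" .
    have "(\<integral>\<^sup>+z1. w (z1, z2) \<partial>\<pi>1) = (\<integral>\<^sup>+z1. ennreal (c (k (fst z2))) * indicator {z. k (snd z) = k (fst z2)} z1 \<partial>\<pi>1)"
      by (intro nn_integral_cong) (auto simp: w_def)
    also have "\<dots> = ennreal (c (k (fst z2))) * ennreal (p (k (fst z2)))"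
      unfolding nn_integral_cmult_indicator[OF 1] em_p ..
    finally show ?thesis by (simp add: ennreal_mult)
  qed
  \<comment> \<open>Both marginals of \<open>Q\<close> have explicit densities with respect to \<open>\<pi>1\<close> and \<open>\<pi>2\<close>, and these densities
    are at most \<open>1\<close>.\<close>
  have int1: "(\<integral>\<^sup>+u. g (fst u) \<partial>Q) = (\<integral>\<^sup>+z. ennreal (c (k (snd z)) * q (k (snd z))) * g z \<partial>\<pi>1)"
    if [measurable]: "g \<in> borel_measurable \<pi>1" for g
  proof -
    have "(\<integral>\<^sup>+u. g (fst u) \<partial>Q) = (\<integral>\<^sup>+u. w u * g (fst u) \<partial>(\<pi>1 \<Otimes>\<^sub>M \<pi>2))"
      unfolding Q_def by (rule nn_integral_density) measurable
    also have "\<dots> = (\<integral>\<^sup>+z1. \<integral>\<^sup>+z2. w (z1, z2) * g z1 \<partial>\<pi>2 \<partial>\<pi>1)"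
      by (subst M2.nn_integral_fst[symmetric]) auto
    also have "\<dots> = (\<integral>\<^sup>+z1. (\<integral>\<^sup>+z2. w (z1, z2) \<partial>\<pi>2) * g z1 \<partial>\<pi>1)"
      by (intro nn_integral_cong nn_integral_multc) measurable
    finally show ?thesis by (simp only: w1)
  qed
  have int2: "(\<integral>\<^sup>+u. g (snd u) \<partial>Q) = (\<integral>\<^sup>+z. ennreal (c (k (fst z)) * p (k (fst z))) * g z \<partial>\<pi>2)"
    if [measurable]: "g \<in> borel_measurable \<pi>2" for g
  proof -
    have "(\<integral>\<^sup>+u. g (snd u) \<partial>Q) = (\<integral>\<^sup>+u. w u * g (snd u) \<partial>(\<pi>1 \<Otimes>\<^sub>M \<pi>2))"
      unfolding Q_def by (rule nn_integral_density) measurable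
    also have "\<dots> = (\<integral>\<^sup>+z2. \<integral>\<^sup>+z1. w (z1, z2) * g z2 \<partial>\<pi>1 \<partial>\<pi>2)"
      by (subst P.nn_integral_snd[symmetric]) auto
    also have "\<dots> = (\<integral>\<^sup>+z2. (\<integral>\<^sup>+z1. w (z1, z2) \<partial>\<pi>1) * g z2 \<partial>\<pi>2)"
      by (intro nn_integral_cong nn_integral_multc) measurable
    finally show ?thesis by (simp only: w2)
  qed
  have shrink: "ennreal r * x \<le> x" if "r \<le> 1" for r and x :: ennreal
    using mult_right_mono[of "ennreal r" 1 x] that by simp
  have int1_le: "(\<integral>\<^sup>+u. g (fst u) \<partial>Q) \<le> (\<integral>\<^sup>+z. g z \<partial>\<pi>1)" if "g \<in> borel_measurable \<pi>1" for g
    unfolding int1[OF that] by (intro nn_integral_mono shrink cq)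
  have int2_le: "(\<integral>\<^sup>+u. g (snd u) \<partial>Q) \<le> (\<integral>\<^sup>+z. g z \<partial>\<pi>2)" if "g \<in> borel_measurable \<pi>2" for g
    unfolding int2[OF that] by (intro nn_integral_mono shrink cp)
  have spQ: "space Q = UNIV" by (simp add: Q_def space_pair_measure)
  have Q_le: "emeasure Q UNIV \<le> emeasure \<pi>1 UNIV"
    using int1_le[of "\<lambda>_. 1"] by (simp add: spQ)
  have finQ: "finite_measure Q"
    using Q_le M1.emeasure_finite[of UNIV] by (intro finite_measureI) (auto simp: spQ top_unique)
  have \<pi>: "\<pi> \<in> finite_borel_measures"
    unfolding \<pi>_def finite_borel_measures_def
    by (auto intro!: finite_measure.finite_measure_distr[OF finQ])
  have int\<pi>: "(\<integral>\<^sup>+z. g z \<partial>\<pi>) = (\<integral>\<^sup>+u. g (J u) \<partial>Q)" if "g \<in> borel_measurable borel" for g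
    unfolding \<pi>_def using that by (intro nn_integral_distr) measurable
  show thesis
  proof (rule that[OF \<pi>])
    show "emeasure (distr \<pi> borel fst) A \<le> emeasure (distr \<pi>1 borel fst) A" if A [measurable]: "A \<in> sets borel" for A
    proof -
      have [measurable]: "fst \<in> borel_measurable (borel :: ('a \<times> 'a) measure)"
        using measurable_on_borel_pairs[of borel] by simp
      have "emeasure (distr \<pi> borel fst) A = (\<integral>\<^sup>+x. indicator A x \<partial>distr \<pi> borel fst)"
        using A by simp
      also have "\<dots> = (\<integral>\<^sup>+z. indicator A (fst z) \<partial>\<pi>)"
        using measurable_on_borel_pairs[of \<pi>] finite_borel_measuresD[OF \<pi>] by (intro nn_integral_distr) auto
      also have "\<dots> = (\<integral>\<^sup>+u. indicator A (fst (fst u)) \<partial>Q)"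
        by (subst int\<pi>) (auto simp: J_def)
      also have "\<dots> \<le> (\<integral>\<^sup>+z. indicator A (fst z) \<partial>\<pi>1)"
        by (rule int1_le) measurable
      also have "\<dots> = (\<integral>\<^sup>+x. indicator A x \<partial>distr \<pi>1 borel fst)"
        by (rule nn_integral_distr[symmetric]) auto
      finally show ?thesis using A by simp
    qed
    show "emeasure (distr \<pi> borel snd) A \<le> emeasure (distr \<pi>2 borel snd) A" if A [measurable]: "A \<in> sets borel" for A
    proof -
      have [measurable]: "snd \<in> borel_measurable (borel :: ('a \<times> 'a) measure)"
        using measurable_on_borel_pairs[of borel] by simp
      have "emeasure (distr \<pi> borel snd) A = (\<integral>\<^sup>+x. indicator A x \<partial>distr \<pi> borel snd)"
        using A by simp
      also have "\<dots> = (\<integral>\<^sup>+z. indicator A (snd z) \<partial>\<pi>)"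
        using measurable_on_borel_pairs[of \<pi>] finite_borel_measuresD[OF \<pi>] by (intro nn_integral_distr) auto
      also have "\<dots> = (\<integral>\<^sup>+u. indicator A (snd (snd u)) \<partial>Q)"
        by (subst int\<pi>) (auto simp: J_def)
      also have "\<dots> \<le> (\<integral>\<^sup>+z. indicator A (snd z) \<partial>\<pi>2)"
        by (rule int2_le) measurable
      also have "\<dots> = (\<integral>\<^sup>+x. indicator A x \<partial>distr \<pi>2 borel snd)"
        by (rule nn_integral_distr[symmetric]) auto
      finally show ?thesis using A by simp
    qed
    show "transport_cost \<pi> \<le> transport_cost \<pi>1 + transport_cost \<pi>2 + ennreal e * emeasure \<pi>1 UNIV"
    proof -
      have "transport_cost \<pi> = (\<integral>\<^sup>+u. ennreal (dist (fst (fst u)) (snd (snd u))) \<partial>Q)"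
        unfolding transport_cost_def
        using int\<pi>[OF measurable_on_borel_pairs(4)[OF refl]] by (simp add: J_def)
      also have "\<dots> = (\<integral>\<^sup>+u. w u * ennreal (dist (fst (fst u)) (snd (snd u))) \<partial>(\<pi>1 \<Otimes>\<^sub>M \<pi>2))"
        unfolding Q_def by (rule nn_integral_density) measurable
      also have "\<dots> \<le> (\<integral>\<^sup>+u. w u * (ennreal (dist (fst (fst u)) (snd (fst u))) + ennreal (dist (fst (snd u)) (snd (snd u))) + ennreal e) \<partial>(\<pi>1 \<Otimes>\<^sub>M \<pi>2))"
      proof (intro nn_integral_mono)
        fix u
        show "w u * ennreal (dist (fst (fst u)) (snd (snd u)))
          \<le> w u * (ennreal (dist (fst (fst u)) (snd (fst u))) + ennreal (dist (fst (snd u)) (snd (snd u))) + ennreal e)"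
        proof (cases "k (snd (fst u)) = k (fst (snd u))")
          case True
          have "dist (fst (fst u)) (snd (snd u)) \<le> dist (fst (fst u)) (snd (fst u)) + dist (fst (snd u)) (snd (snd u)) + e"
            using k(2)[OF True] dist_triangle[of "fst (fst u)" "snd (snd u)" "snd (fst u)"]
              dist_triangle[of "snd (fst u)" "snd (snd u)" "fst (snd u)"] by linarith
          then show ?thesis
            using e by (intro mult_left_mono) (auto simp flip: ennreal_plus intro: ennreal_leI)
        qed (simp add: w_def)
      qed
      also have "\<dots> = (\<integral>\<^sup>+u. ennreal (dist (fst (fst u)) (snd (fst u))) + ennreal (dist (fst (snd u)) (snd (snd u))) + ennreal e \<partial>Q)"
        unfolding Q_def by (rule nn_integral_density[symmetric]) measurable
      also have "\<dots> = (\<integral>\<^sup>+u. ennreal (dist (fst (fst u)) (snd (fst u))) \<partial>Q) + (\<integral>\<^sup>+u. ennreal (dist (fst (snd u)) (snd (snd u))) \<partial>Q) + ennreal e * emeasure Q UNIV"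
        by (simp add: nn_integral_add spQ)
      also have "\<dots> \<le> transport_cost \<pi>1 + transport_cost \<pi>2 + ennreal e * emeasure \<pi>1 UNIV"
        unfolding transport_cost_def
        by (intro add_mono mult_left_mono Q_le int1_le int2_le) auto
      finally show ?thesis .
    qed
    show "ennreal (measure \<pi>1 UNIV - measure \<pi> UNIV) + ennreal (measure \<pi>2 UNIV - measure \<pi> UNIV)
      \<le> tv_dist (distr \<pi>1 borel snd) (distr \<pi>2 borel fst)"
    proof -
      let ?n1 = "distr \<pi>1 borel snd" and ?n2 = "distr \<pi>2 borel fst"
      interpret n1: finite_measure ?n1 using marginals(2)[OF M(1)] by (rule finite_borel_measuresD)
      interpret n2: finite_measure ?n2 using marginals(1)[OF M(2)] by (rule finite_borel_measuresD)
      \<comment> \<open>On the cells in \<open>H\<close> the outgoing mass is the smaller one, on the other cells the incoming mass.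
        Hence the glued mass is the outgoing mass of \<open>H\<close> plus the incoming mass of its complement.\<close>
      define H where "H = {y. q (k y) \<le> p (k y)}"
      have H [measurable]: "H \<in> sets borel"
        using measurable_sets[OF k(1), of "{i. q i \<le> p i}"] by (simp add: H_def vimage_def)
      have "emeasure Q UNIV = (\<integral>\<^sup>+z. ennreal (c (k (snd z)) * q (k (snd z))) \<partial>\<pi>1)"
        using int1[of "\<lambda>_. 1"] by (simp add: spQ)
      also have "\<dots> = (\<Sum>i. ennreal (c i * q i) * emeasure \<pi>1 {z \<in> space \<pi>1. k (snd z) = i})"
        by (rule nn_integral_nat_valued) measurable
      also have "\<dots> = (\<Sum>i. (if q i \<le> p i then 1 else 0) * ennreal (q i) + (if q i \<le> p i then 0 else 1) * ennreal (p i))"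
        by (intro suminf_cong) (auto simp: em_p cqp simp flip: ennreal_mult)
      also have "\<dots> = (\<Sum>i. (if q i \<le> p i then 1 else 0) * emeasure \<pi>2 {z \<in> space \<pi>2. k (fst z) = i})
          + (\<Sum>i. (if q i \<le> p i then 0 else 1) * emeasure \<pi>1 {z \<in> space \<pi>1. k (snd z) = i})"
        by (simp add: em_p em_q suminf_add)
      also have "\<dots> = (\<integral>\<^sup>+z. (if q (k (fst z)) \<le> p (k (fst z)) then 1 else 0) \<partial>\<pi>2)
          + (\<integral>\<^sup>+z. (if q (k (snd z)) \<le> p (k (snd z)) then 0 else 1) \<partial>\<pi>1)"
        by (intro arg_cong2[of _ _ _ _ "(+)"] nn_integral_nat_valued[symmetric]) measurable
      also have "\<dots> = (\<integral>\<^sup>+z. indicator H (fst z) \<partial>\<pi>2) + (\<integral>\<^sup>+z. indicator (- H) (snd z) \<partial>\<pi>1)"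
        by (intro arg_cong2[of _ _ _ _ "(+)"] nn_integral_cong) (auto simp: H_def)
      also have "\<dots> = (\<integral>\<^sup>+y. indicator H y \<partial>?n2) + (\<integral>\<^sup>+y. indicator (- H) y \<partial>?n1)"
        by (intro arg_cong2[of _ _ _ _ "(+)"] nn_integral_distr[symmetric]) measurable
      also have "\<dots> = emeasure ?n2 H + emeasure ?n1 (- H)" by simp
      finally have "measure Q UNIV = measure ?n2 H + measure ?n1 (- H)"
        by (simp add: measure_def enn2real_plus n1.emeasure_finite n2.emeasure_finite less_top[symmetric])
      moreover have "measure \<pi> UNIV = measure Q UNIV"
        unfolding \<pi>_def by (subst measure_distr) (auto simp: spQ)
      ultimately have m: "measure \<pi> UNIV = measure ?n2 H + measure ?n1 (- H)" by simp
      have split1: "measure \<pi>1 UNIV = measure ?n1 H + measure ?n1 (- H)"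
        using n1.finite_measure_compl[of H] marginals(6)[OF M(1)] by (simp add: Compl_eq_Diff_UNIV)
      have split2: "measure \<pi>2 UNIV = measure ?n2 H + measure ?n2 (- H)"
        using n2.finite_measure_compl[of H] marginals(5)[OF M(2)] by (simp add: Compl_eq_Diff_UNIV)
      have "ennreal (measure \<pi>1 UNIV - measure \<pi> UNIV) + ennreal (measure \<pi>2 UNIV - measure \<pi> UNIV)
        \<le> ennreal \<bar>measure ?n1 H - measure ?n2 H\<bar> + ennreal \<bar>measure ?n1 (- H) - measure ?n2 (- H)\<bar>"
        unfolding m split1 split2 by (intro add_mono ennreal_leI) auto
      also have "\<dots> \<le> tv_dist ?n1 ?n2"
        using total_variation_ge_two_sets[OF H, of "\<lambda>A. measure ?n1 A - measure ?n2 A"] by simp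
      finally show ?thesis .
    qed
  qed
qed

text \<open>The mass that approximate gluing loses at the two ends is bounded by the distance of the middle
marginals, hence by the sum of their distances to \<open>\<nu>\<close>. These are exactly the two penalties at \<open>\<nu>\<close>
that the costs of the two given plans contain and the cost of the glued plan does not.\<close>

lemma unbalanced_cost_triangle:
  fixes \<mu> \<nu> \<rho> :: "'a::polish_space measure"
  assumes a: "a > 0" and b: "b > 0"
  shows "unbalanced_cost a b \<mu> \<rho> \<le> unbalanced_cost a b \<mu> \<nu> + unbalanced_cost a b \<nu> \<rho>"
proof -
  have plans: "unbalanced_cost a b \<mu> \<rho> \<le> plan_cost a b \<mu> \<nu> \<pi>1 + plan_cost a b \<nu> \<rho> \<pi>2"
    if M: "\<pi>1 \<in> finite_borel_measures" "\<pi>2 \<in> finite_borel_measures" for \<pi>1 \<pi>2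
  proof (rule ennreal_le_epsilon)
    fix e :: real
    assume e: "e > 0"
    interpret M1: finite_measure \<pi>1 using finite_borel_measuresD[OF M(1)] by simp
    define m where "m = measure \<pi>1 UNIV"
    have m: "m \<ge> 0" "emeasure \<pi>1 UNIV = ennreal m" by (simp_all add: m_def M1.emeasure_eq_measure)
    \<comment> \<open>The diameter of the cells is chosen such that the jumps cost at most \<open>e\<close> in total, and \<open>m + 1\<close>
      avoids a division by zero.\<close>
    define e' where "e' = e / (b * (m + 1))"
    have e': "e' > 0" "b * (e' * m) \<le> e"
    proof -
      have pos: "b * (m + 1) > 0" using b m by simp
      then show "e' > 0" using e by (simp add: e'_def)
      then have "b * (e' * m) \<le> e' * (b * (m + 1))" using b by (simp add: algebra_simps)
      also have "\<dots> = e" by (metis e'_def less_irrefl nonzero_eq_divide_eq pos)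
      finally show "b * (e' * m) \<le> e" .
    qed
    show "unbalanced_cost a b \<mu> \<rho> \<le> plan_cost a b \<mu> \<nu> \<pi>1 + plan_cost a b \<nu> \<rho> \<pi>2 + ennreal e"
    proof (rule approximate_gluing[OF M e'(1)])
      fix \<pi> :: "('a \<times> 'a) measure"
      assume \<pi>: "\<pi> \<in> finite_borel_measures"
        and sub: "\<And>A. A \<in> sets borel \<Longrightarrow> emeasure (distr \<pi> borel fst) A \<le> emeasure (distr \<pi>1 borel fst) A"
          "\<And>A. A \<in> sets borel \<Longrightarrow> emeasure (distr \<pi> borel snd) A \<le> emeasure (distr \<pi>2 borel snd) A"
        and defect: "ennreal (measure \<pi>1 UNIV - measure \<pi> UNIV) + ennreal (measure \<pi>2 UNIV - measure \<pi> UNIV)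
          \<le> tv_dist (distr \<pi>1 borel snd) (distr \<pi>2 borel fst)"
        and cost: "transport_cost \<pi> \<le> transport_cost \<pi>1 + transport_cost \<pi>2 + ennreal e' * emeasure \<pi>1 UNIV"
      let ?d1 = "ennreal (measure \<pi>1 UNIV - measure \<pi> UNIV)"
      let ?d2 = "ennreal (measure \<pi>2 UNIV - measure \<pi> UNIV)"
      have tv1: "tv_dist \<mu> (distr \<pi> borel fst) \<le> tv_dist \<mu> (distr \<pi>1 borel fst) + ?d1"
        using tv_dist_shrink[OF marginals(1)[OF M(1)] marginals(1)[OF \<pi>] sub(1), of \<mu>]
        by (simp add: marginals(5)[OF M(1)] marginals(5)[OF \<pi>])
      have tv2: "tv_dist \<rho> (distr \<pi> borel snd) \<le> tv_dist \<rho> (distr \<pi>2 borel snd) + ?d2"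
        using tv_dist_shrink[OF marginals(2)[OF M(2)] marginals(2)[OF \<pi>] sub(2), of \<rho>]
        by (simp add: marginals(6)[OF M(2)] marginals(6)[OF \<pi>])
      have d: "?d1 + ?d2 \<le> tv_dist \<nu> (distr \<pi>1 borel snd) + tv_dist \<nu> (distr \<pi>2 borel fst)"
        using defect tv_dist_triangle[of "distr \<pi>1 borel snd" "distr \<pi>2 borel fst" \<nu>]
        by (simp add: tv_dist_commute[of "distr \<pi>1 borel snd" \<nu>])
      have "unbalanced_cost a b \<mu> \<rho> \<le> plan_cost a b \<mu> \<rho> \<pi>"
        by (rule unbalanced_cost_le_plan_cost[OF \<pi>])
      also have "\<dots> \<le> ennreal a * (tv_dist \<mu> (distr \<pi>1 borel fst) + ?d1)
          + ennreal a * (tv_dist \<rho> (distr \<pi>2 borel snd) + ?d2)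
          + ennreal b * (transport_cost \<pi>1 + transport_cost \<pi>2 + ennreal e' * emeasure \<pi>1 UNIV)"
        unfolding plan_cost_def by (intro add_mono mult_left_mono tv1 tv2 cost) auto
      also have "\<dots> = ennreal a * tv_dist \<mu> (distr \<pi>1 borel fst) + ennreal a * tv_dist \<rho> (distr \<pi>2 borel snd)
          + ennreal a * (?d1 + ?d2) + ennreal b * transport_cost \<pi>1 + ennreal b * transport_cost \<pi>2
          + ennreal (b * (e' * m))"
        using b e'(1) m by (simp add: distrib_left ac_simps ennreal_mult)
      also have "\<dots> \<le> ennreal a * tv_dist \<mu> (distr \<pi>1 borel fst) + ennreal a * tv_dist \<rho> (distr \<pi>2 borel snd)
          + ennreal a * (tv_dist \<nu> (distr \<pi>1 borel snd) + tv_dist \<nu> (distr \<pi>2 borel fst))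
          + ennreal b * transport_cost \<pi>1 + ennreal b * transport_cost \<pi>2 + ennreal e"
        by (intro add_mono mult_left_mono d ennreal_leI e') auto
      also have "\<dots> = plan_cost a b \<mu> \<nu> \<pi>1 + plan_cost a b \<nu> \<rho> \<pi>2 + ennreal e"
        unfolding plan_cost_def by (simp add: distrib_left ac_simps)
      finally show "unbalanced_cost a b \<mu> \<rho> \<le> plan_cost a b \<mu> \<nu> \<pi>1 + plan_cost a b \<nu> \<rho> \<pi>2 + ennreal e" .
    qed
  qed
  have "unbalanced_cost a b \<mu> \<rho> \<le> unbalanced_cost a b \<nu> \<rho> + plan_cost a b \<mu> \<nu> \<pi>1"
    if "\<pi>1 \<in> finite_borel_measures" for \<pi>1
    using ennreal_le_add_mult_INF[of 1 finite_borel_measures "unbalanced_cost a b \<mu> \<rho>" "plan_cost a b \<mu> \<nu> \<pi>1" "plan_cost a b \<nu> \<rho>"]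
      plans[OF that] by (simp add: unbalanced_cost_def[of a b \<nu> \<rho>] add.commute)
  then show ?thesis
    using ennreal_le_add_mult_INF[of 1 finite_borel_measures "unbalanced_cost a b \<mu> \<rho>" "unbalanced_cost a b \<nu> \<rho>" "plan_cost a b \<mu> \<nu>"]
    by (simp add: unbalanced_cost_def[of a b \<mu> \<nu>] add.commute)
qed

section \<open>The generalized Wasserstein distance is a metric\<close>

text \<open>The zero plan, which transports nothing, has finite cost.\<close>

lemma unbalanced_cost_finite:
  fixes \<mu> \<nu> :: "'a::metric_space measure"
  assumes "\<mu> \<in> finite_borel_measures" "\<nu> \<in> finite_borel_measures"
  shows "unbalanced_cost a b \<mu> \<nu> < top"
proof -
  let ?o = "null_measure borel :: ('a \<times> 'a) measure"
  have o: "?o \<in> finite_borel_measures"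
    by (auto simp: finite_borel_measures_def intro!: finite_measureI)
  have "distr ?o borel fst = null_measure borel" "distr ?o borel snd = null_measure borel"
    using marginals(3,4)[OF o] by (auto intro!: measure_eqI)
  then have "plan_cost a b \<mu> \<nu> ?o = ennreal a * tv_dist \<mu> (null_measure borel) + ennreal a * tv_dist \<nu> (null_measure borel)"
    by (simp add: plan_cost_def transport_cost_def)
  also have "\<dots> < top"
    using assms[THEN tv_dist_null_finite] by (simp add: ennreal_mult_less_top)
  finally show ?thesis by (rule le_less_trans[OF unbalanced_cost_le_plan_cost[OF o]])
qed

lemma unbalanced_cost_commute:
  fixes \<mu> \<nu> :: "'a::metric_space measure"
  shows "unbalanced_cost a b \<mu> \<nu> = unbalanced_cost a b \<nu> \<mu>"
proof -
  have "unbalanced_cost a b \<mu> \<nu> \<le> unbalanced_cost a b \<nu> \<mu>" for \<mu> \<nu> :: "'a measure"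
    unfolding unbalanced_cost_def[of a b \<nu> \<mu>]
  proof (rule INF_greatest)
    fix \<pi> :: "('a \<times> 'a) measure"
    assume \<pi>: "\<pi> \<in> finite_borel_measures"
    note meas = measurable_on_borel_pairs[OF finite_borel_measuresD(1)[OF \<pi>]]
    note meas_borel = measurable_on_borel_pairs[of "borel :: ('a \<times> 'a) measure", OF refl]
    let ?p = "distr \<pi> borel (\<lambda>z. (snd z, fst z))"
    have p: "?p \<in> finite_borel_measures" by (intro finite_borel_measures_distr \<pi> meas)
    have "distr ?p borel fst = distr \<pi> borel snd" "distr ?p borel snd = distr \<pi> borel fst"
      by (simp_all add: distr_distr meas meas_borel comp_def)
    moreover have "transport_cost ?p = transport_cost \<pi>"
      unfolding transport_cost_def
      by (simp add: nn_integral_distr[OF meas(3)] meas_borel dist_commute)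
    ultimately have "plan_cost a b \<mu> \<nu> ?p = plan_cost a b \<nu> \<mu> \<pi>"
      by (simp add: plan_cost_def ac_simps)
    then show "unbalanced_cost a b \<mu> \<nu> \<le> plan_cost a b \<nu> \<mu> \<pi>"
      using unbalanced_cost_le_plan_cost[OF p, of a b \<mu> \<nu>] by simp
  qed
  then show ?thesis by (intro antisym)
qed

text \<open>A plan moves the mass of \<open>C\<close> either into the closed \<open>r\<close>-neighbourhood of \<open>C\<close> or by a distance of at least
\<open>r\<close>. By Markov's inequality the transport cost bounds the second part, and the penalties bound the
difference between the marginals and the measures. The factor is chosen such that its products with
\<open>a\<close> and \<open>b\<close> are at least \<open>1\<close> and \<open>1 / r\<close>.\<close>

lemma closed_mass_le:
  fixes \<mu> \<nu> :: "'a::polish_space measure"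
  assumes a: "a > 0" and b: "b > 0" and r: "r > 0"
    and M: "\<mu> \<in> finite_borel_measures" "\<nu> \<in> finite_borel_measures"
    and C: "closed C" "C \<noteq> {}"
  shows "emeasure \<mu> C \<le> emeasure \<nu> {y. infdist y C \<le> r} + ennreal (1 / a + 1 / (b * r)) * unbalanced_cost a b \<mu> \<nu>"
  unfolding unbalanced_cost_def
proof (rule ennreal_le_add_mult_INF)
  show "0 < ennreal (1 / a + 1 / (b * r))" "ennreal (1 / a + 1 / (b * r)) < top"
    using a b r by (auto simp: add_pos_pos)
  fix \<pi> :: "('a \<times> 'a) measure"
  assume \<pi>: "\<pi> \<in> finite_borel_measures"
  note [simp] = finite_borel_measuresD[OF \<pi>]
  note [measurable] = measurable_on_borel_pairs[of \<pi>, simplified]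
  define N where "N = {y. infdist y C \<le> r}"
  have "closed N" unfolding N_def by (intro closed_Collect_le continuous_intros)
  then have N: "N \<in> sets borel" by simp
  have em: "ennreal (measure \<rho> A) = emeasure \<rho> A" if "\<rho> \<in> finite_borel_measures" for \<rho> :: "'a measure" and A
    using finite_measure.emeasure_eq_measure[OF finite_borel_measuresD(2)[OF that]] by simp
  let ?n1 = "distr \<pi> borel fst" and ?n2 = "distr \<pi> borel snd"
  have far_meas: "{z \<in> space \<pi>. 1 \<le> ennreal (1 / r) * ennreal (dist (fst z) (snd z))} \<in> sets \<pi>" (is "?F \<in> _")
    by measurable
  have "emeasure ?n1 C = emeasure \<pi> (C \<times> UNIV)"
    using C by (intro marginals(3)[OF \<pi>]) simp
  also have "\<dots> \<le> emeasure \<pi> ((UNIV \<times> N) \<union> ?F)"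
  proof (rule emeasure_mono)
    show "C \<times> UNIV \<subseteq> (UNIV \<times> N) \<union> ?F"
    proof (clarsimp simp flip: ennreal_mult)
      fix x y
      assume "x \<in> C" "y \<notin> N"
      then have "r \<le> dist x y"
        using infdist_le[of x C y] by (simp add: N_def dist_commute)
      then show "1 \<le> ennreal (1 / r) * ennreal (dist x y)"
        using r by (simp flip: ennreal_mult add: divide_simps)
    qed
    have "UNIV \<times> N = {z \<in> space \<pi>. snd z \<in> N}" by auto
    also have "\<dots> \<in> sets \<pi>" using N by measurable
    finally show "(UNIV \<times> N) \<union> ?F \<in> sets \<pi>" using far_meas by auto
  qed
  also have "\<dots> \<le> emeasure \<pi> (UNIV \<times> N) + emeasure \<pi> ?F"
  proof (rule emeasure_subadditive[OF _ far_meas])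
    have "UNIV \<times> N = {z \<in> space \<pi>. snd z \<in> N}" by auto
    also have "\<dots> \<in> sets \<pi>" using N by measurable
    finally show "UNIV \<times> N \<in> sets \<pi>" .
  qed
  also have "\<dots> \<le> emeasure ?n2 N + ennreal (1 / r) * transport_cost \<pi>"
  proof (intro add_mono)
    show "emeasure \<pi> (UNIV \<times> N) \<le> emeasure ?n2 N" using marginals(4)[OF \<pi> N] by simp
    have "emeasure \<pi> {z \<in> UNIV. 1 \<le> ennreal (1 / r) * ennreal (dist (fst z) (snd z))}
      \<le> ennreal (1 / r) * (\<integral>\<^sup>+z. ennreal (dist (fst z) (snd z)) * indicator UNIV z \<partial>\<pi>)"
      by (rule nn_integral_Markov_inequality) auto
    then show "emeasure \<pi> ?F \<le> ennreal (1 / r) * transport_cost \<pi>"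
      by (simp add: transport_cost_def)
  qed
  finally have main: "emeasure ?n1 C \<le> emeasure ?n2 N + ennreal (1 / r) * transport_cost \<pi>" .
  have 1: "emeasure \<mu> C \<le> emeasure ?n1 C + tv_dist \<mu> ?n1"
    using measure_diff_le_tv_dist[of C \<mu> ?n1] C by (simp add: em M marginals[OF \<pi>])
  have 2: "emeasure ?n2 N \<le> emeasure \<nu> N + tv_dist \<nu> ?n2"
    using measure_diff_le_tv_dist[of N ?n2 \<nu>] N by (simp add: em M marginals[OF \<pi>] tv_dist_commute[of ?n2])
  let ?K = "1 / a + 1 / (b * r)"
  have K: "1 \<le> ?K * a" "1 / r \<le> ?K * b" "0 \<le> ?K"
    using a b r by (auto simp: field_simps)
  have "emeasure \<mu> C \<le> (emeasure ?n2 N + ennreal (1 / r) * transport_cost \<pi>) + tv_dist \<mu> ?n1"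
    using 1 main by (meson add_right_mono order_trans)
  also have "\<dots> \<le> ((emeasure \<nu> N + tv_dist \<nu> ?n2) + ennreal (1 / r) * transport_cost \<pi>) + tv_dist \<mu> ?n1"
    by (intro add_mono 2 order_refl)
  also have "\<dots> = emeasure \<nu> N + (1 * tv_dist \<mu> ?n1 + 1 * tv_dist \<nu> ?n2 + ennreal (1 / r) * transport_cost \<pi>)"
    by (simp add: ac_simps)
  also have "\<dots> \<le> emeasure \<nu> N + (ennreal (?K * a) * tv_dist \<mu> ?n1 + ennreal (?K * a) * tv_dist \<nu> ?n2 + ennreal (?K * b) * transport_cost \<pi>)"
    using K by (intro add_mono mult_right_mono ennreal_leI order_refl) auto
  also have "\<dots> = emeasure \<nu> N + ennreal ?K * plan_cost a b \<mu> \<nu> \<pi>"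
    using K a b by (simp only: plan_cost_def distrib_left ennreal_mult[OF K(3)] less_imp_le mult.assoc)
  finally show "emeasure \<mu> C \<le> emeasure \<nu> {y. infdist y C \<le> r} + ennreal ?K * plan_cost a b \<mu> \<nu> \<pi>"
    by (simp add: N_def)
qed

text \<open>The closed neighbourhoods of a closed set shrink to the set itself.\<close>

lemma unbalanced_cost_eq_0_closed:
  fixes \<mu> \<nu> :: "'a::polish_space measure"
  assumes a: "a > 0" and b: "b > 0"
    and M: "\<mu> \<in> finite_borel_measures" "\<nu> \<in> finite_borel_measures"
    and zero: "unbalanced_cost a b \<mu> \<nu> = 0" and C: "closed C"
  shows "emeasure \<mu> C \<le> emeasure \<nu> C"
proof (cases "C = {}")
  case False
  interpret \<nu>: finite_measure \<nu> using finite_borel_measuresD[OF M(2)] by simp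
  define N where "N n = {y. infdist y C \<le> 1 / real (Suc n)}" for n
  have "closed (N n)" for n unfolding N_def by (intro closed_Collect_le continuous_intros)
  then have N: "range N \<subseteq> sets \<nu>" by (auto simp: finite_borel_measuresD[OF M(2)])
  have "decseq N"
    unfolding N_def decseq_def by (auto elim!: order_trans simp: frac_le)
  then have "(\<lambda>n. emeasure \<nu> (N n)) \<longlonglongrightarrow> emeasure \<nu> (\<Inter>n. N n)"
    using N by (intro Lim_emeasure_decseq) auto
  moreover have "(\<Inter>n. N n) = C"
  proof (intro equalityI subsetI)
    fix y assume y: "y \<in> (\<Inter>n. N n)"
    have "infdist y C \<le> 0"
    proof (rule field_le_epsilon)
      fix e :: real assume "e > 0"
      then obtain n where "1 / real (Suc n) < e" using nat_approx_posE by blast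
      with y show "infdist y C \<le> 0 + e" by (auto simp: N_def intro: order_trans[of _ "1 / real (Suc n)"])
    qed
    then show "y \<in> C" using in_closed_iff_infdist_zero[OF C False] infdist_nonneg[of y C] by auto
  qed (auto simp: N_def in_closed_iff_infdist_zero[OF C False])
  moreover have "emeasure \<mu> C \<le> emeasure \<nu> (N n)" for n
    using closed_mass_le[OF a b _ M C False, of "1 / real (Suc n)"] by (simp add: zero N_def)
  ultimately show ?thesis by (intro LIMSEQ_le_const[of "\<lambda>n. emeasure \<nu> (N n)"]) auto
qed simp

lemma finite_borel_measures_eqI_closed:
  assumes M: "\<mu> \<in> finite_borel_measures" "\<nu> \<in> finite_borel_measures"
    and eq: "\<And>C. closed C \<Longrightarrow> emeasure \<mu> C = emeasure \<nu> C"
  shows "\<mu> = \<nu>"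
proof (rule measure_eqI_generator_eq[where E = "Collect closed" and \<Omega> = UNIV and A = "\<lambda>_. UNIV"])
  show "emeasure \<mu> UNIV \<noteq> \<infinity>" for i :: nat
    using finite_measure.emeasure_finite[OF finite_borel_measuresD(2)[OF M(1)]] by simp
qed (use eq in \<open>auto simp: Int_stable_def finite_borel_measuresD[OF M(1)] finite_borel_measuresD[OF M(2)] borel_eq_closed\<close>)

lemma unbalanced_cost_eq_0_iff:
  fixes \<mu> \<nu> :: "'a::polish_space measure"
  assumes "a > 0" "b > 0" and M: "\<mu> \<in> finite_borel_measures" "\<nu> \<in> finite_borel_measures"
  shows "unbalanced_cost a b \<mu> \<nu> = 0 \<longleftrightarrow> \<mu> = \<nu>"
proof
  assume zero: "unbalanced_cost a b \<mu> \<nu> = 0"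
  then have "unbalanced_cost a b \<nu> \<mu> = 0" by (simp add: unbalanced_cost_commute)
  with zero show "\<mu> = \<nu>"
    using assms by (intro finite_borel_measures_eqI_closed antisym unbalanced_cost_eq_0_closed) auto
next
  assume "\<mu> = \<nu>"
  have d: "(\<lambda>x. (x, x)) \<in> \<mu> \<rightarrow>\<^sub>M (borel :: ('a \<times> 'a) measure)"
    using borel_measurable_continuous_onI[of "\<lambda>x :: 'a. (x, x)"]
    by (simp add: finite_borel_measuresD[OF M(1)] continuous_intros cong: measurable_cong_sets)
  let ?p = "distr \<mu> borel (\<lambda>x. (x, x))"
  have p: "?p \<in> finite_borel_measures" by (intro finite_borel_measures_distr M d)
  note meas = measurable_on_borel_pairs[of "borel :: ('a \<times> 'a) measure", OF refl]
  have "distr ?p borel fst = \<mu>" "distr ?p borel snd = \<mu>"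
    using finite_borel_measuresD[OF M(1)] by (simp_all add: distr_distr d meas comp_def distr_id2)
  moreover have "transport_cost ?p = 0"
    by (simp add: transport_cost_def nn_integral_distr[OF d] meas)
  ultimately have "plan_cost a b \<mu> \<mu> ?p = 0"
    using total_variation_leI[of "\<lambda>A. measure \<mu> A - measure \<mu> A" 0] by (simp add: plan_cost_def)
  then have "unbalanced_cost a b \<mu> \<mu> \<le> 0"
    using unbalanced_cost_le_plan_cost[OF p, of a b \<mu> \<mu>] by simp
  then show "unbalanced_cost a b \<mu> \<nu> = 0" using \<open>\<mu> = \<nu>\<close> by simp
qed

lemma ennreal_gen_wasserstein1:
  fixes \<mu> \<nu> :: "'a::polish_space measure"
  assumes "a > 0" "b > 0" and M: "\<mu> \<in> finite_borel_measures" "\<nu> \<in> finite_borel_measures"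
  shows "ennreal (gen_wasserstein1 a b \<mu> \<nu>) = unbalanced_cost a b \<mu> \<nu>"
  unfolding gen_wasserstein1_eq_unbalanced_cost[OF assms(1,2)]
  using unbalanced_cost_finite[OF M] by simp

lemma gen_wasserstein1_nonneg: "0 \<le> gen_wasserstein1 a b \<mu> \<nu>"
  by (simp add: gen_wasserstein1_def)

theorem Metric_space_gen_wasserstein1:
  assumes ab: "a > 0" "b > 0"
  shows "Metric_space (finite_borel_measures :: 'a::polish_space measure set) (gen_wasserstein1 a b)"
proof
  fix \<mu> \<nu> \<rho> :: "'a measure"
  show "0 \<le> gen_wasserstein1 a b \<mu> \<nu>" by (rule gen_wasserstein1_nonneg)
  show "gen_wasserstein1 a b \<mu> \<nu> = gen_wasserstein1 a b \<nu> \<mu>"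
    by (simp add: gen_wasserstein1_eq_unbalanced_cost[OF ab] unbalanced_cost_commute[of a b \<mu>])
  assume M: "\<mu> \<in> finite_borel_measures" "\<nu> \<in> finite_borel_measures"
  show "gen_wasserstein1 a b \<mu> \<nu> = 0 \<longleftrightarrow> \<mu> = \<nu>"
    using unbalanced_cost_eq_0_iff[OF ab M] unbalanced_cost_finite[OF M, of a b]
    by (simp add: gen_wasserstein1_eq_unbalanced_cost[OF ab] enn2real_eq_0_iff less_top[symmetric])
  assume R: "\<rho> \<in> finite_borel_measures"
  have "ennreal (gen_wasserstein1 a b \<mu> \<rho>) \<le> ennreal (gen_wasserstein1 a b \<mu> \<nu> + gen_wasserstein1 a b \<nu> \<rho>)"
    using unbalanced_cost_triangle[OF ab, of \<mu> \<rho> \<nu>] M R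
    by (simp add: gen_wasserstein1_nonneg ennreal_plus ennreal_gen_wasserstein1[OF ab])
  then show "gen_wasserstein1 a b \<mu> \<rho> \<le> gen_wasserstein1 a b \<mu> \<nu> + gen_wasserstein1 a b \<nu> \<rho>"
    by (rule iffD1[OF ennreal_le_iff, rotated]) (intro add_nonneg_nonneg gen_wasserstein1_nonneg)
qed

section \<open>Linear interpolation\<close>

text \<open>A common part \<open>\<eta>\<close> of both measures can stay where it is: adding to the scaled plan the image of \<open>\<eta>\<close> on
the diagonal adds \<open>\<eta>\<close> to both marginals and nothing to the cost.\<close>

lemma unbalanced_cost_scale_add_le:
  fixes \<mu> \<nu> \<eta> :: "'a::polish_space measure"
  assumes c: "c > 0"
    and M: "\<mu> \<in> finite_borel_measures" "\<nu> \<in> finite_borel_measures" "\<eta> \<in> finite_borel_measures"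
  shows "unbalanced_cost a b (add_measure (scale_measure (ennreal c) \<mu>) \<eta>)
      (add_measure (scale_measure (ennreal c) \<nu>) \<eta>) \<le> ennreal c * unbalanced_cost a b \<mu> \<nu>"
proof -
  let ?\<mu> = "add_measure (scale_measure (ennreal c) \<mu>) \<eta>" and ?\<nu> = "add_measure (scale_measure (ennreal c) \<nu>) \<eta>"
  have plan: "unbalanced_cost a b ?\<mu> ?\<nu> \<le> ennreal c * plan_cost a b \<mu> \<nu> \<pi>" if \<pi>: "\<pi> \<in> finite_borel_measures" for \<pi>
  proof -
    have d: "(\<lambda>x. (x, x)) \<in> \<eta> \<rightarrow>\<^sub>M (borel :: ('a \<times> 'a) measure)"
      using borel_measurable_continuous_onI[of "\<lambda>x :: 'a. (x, x)"]
      by (simp add: finite_borel_measuresD[OF M(3)] continuous_intros cong: measurable_cong_sets)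
    let ?d = "distr \<eta> borel (\<lambda>x. (x, x))"
    let ?s = "scale_measure (ennreal c) \<pi>"
    let ?p = "add_measure ?s ?d"
    have D: "?d \<in> finite_borel_measures" by (intro finite_borel_measures_distr M d)
    have S: "?s \<in> finite_borel_measures" by (rule scale_finite_borel_measures[OF \<pi>])
    have P: "?p \<in> finite_borel_measures" by (rule finite_borel_measures_add[OF S D])
    note meas = measurable_on_borel_pairs[of "borel :: ('a \<times> 'a) measure", OF refl]
    have dd: "distr ?d borel fst = \<eta>" "distr ?d borel snd = \<eta>"
      using finite_borel_measuresD[OF M(3)] by (simp_all add: distr_distr d meas comp_def distr_id2)
    have marg: "measure (distr \<rho> borel fst) A = measure \<rho> (A \<times> UNIV)" "measure (distr \<rho> borel snd) A = measure \<rho> (UNIV \<times> A)"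
      if "\<rho> \<in> finite_borel_measures" "A \<in> sets borel" for \<rho> :: "('a \<times> 'a) measure" and A
      using marginals(3,4)[OF that] by (simp_all add: measure_def)
    have m1: "measure (distr ?p borel fst) A = c * measure (distr \<pi> borel fst) A + measure \<eta> A"
      and m2: "measure (distr ?p borel snd) A = c * measure (distr \<pi> borel snd) A + measure \<eta> A"
      if "A \<in> sets borel" for A
      using c marg[OF P that] marg[OF \<pi> that] marg[OF D that]
      by (simp_all add: dd measure_add_measure[OF S D])
    have n: "measure (add_measure (scale_measure (ennreal c) \<rho>) \<eta>) A = c * measure \<rho> A + measure \<eta> A"
      if "\<rho> \<in> finite_borel_measures" for \<rho> A
      using c measure_add_measure[OF scale_finite_borel_measures[OF that] M(3)] by simp
    have tv1: "tv_dist ?\<mu> (distr ?p borel fst) \<le> ennreal c * tv_dist \<mu> (distr \<pi> borel fst)"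
      using c by (intro total_variation_scale_le) (simp_all add: m1 n[OF M(1)] algebra_simps)
    have tv2: "tv_dist ?\<nu> (distr ?p borel snd) \<le> ennreal c * tv_dist \<nu> (distr \<pi> borel snd)"
      using c by (intro total_variation_scale_le) (simp_all add: m2 n[OF M(2)] algebra_simps)
    have "transport_cost ?p = transport_cost ?s + transport_cost ?d"
      unfolding transport_cost_def
      using finite_borel_measuresD(1)[OF S] by (intro nn_integral_add_measure measurable_on_borel_pairs) auto
    also have "transport_cost ?s = ennreal c * transport_cost \<pi>"
      using measurable_on_borel_pairs(4)[OF finite_borel_measuresD(1)[OF \<pi>]]
      by (simp add: transport_cost_def nn_integral_scale_measure)
    also have "transport_cost ?d = 0"
      by (simp add: transport_cost_def nn_integral_distr[OF d] meas)
    finally have cost: "transport_cost ?p = ennreal c * transport_cost \<pi>" by simp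
    have "unbalanced_cost a b ?\<mu> ?\<nu> \<le> plan_cost a b ?\<mu> ?\<nu> ?p"
      by (rule unbalanced_cost_le_plan_cost[OF P])
    also have "\<dots> \<le> ennreal a * (ennreal c * tv_dist \<mu> (distr \<pi> borel fst))
        + ennreal a * (ennreal c * tv_dist \<nu> (distr \<pi> borel snd)) + ennreal b * (ennreal c * transport_cost \<pi>)"
      unfolding plan_cost_def cost by (intro add_mono mult_left_mono tv1 tv2 order_refl) auto
    also have "\<dots> = ennreal c * plan_cost a b \<mu> \<nu> \<pi>"
      by (simp add: plan_cost_def distrib_left ac_simps)
    finally show ?thesis .
  qed
  show ?thesis
    using ennreal_le_add_mult_INF[of "ennreal c" finite_borel_measures "unbalanced_cost a b ?\<mu> ?\<nu>" 0 "plan_cost a b \<mu> \<nu>"] c plan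
    by (simp add: unbalanced_cost_def[of a b \<mu> \<nu>])
qed

definition segment :: "'a measure \<Rightarrow> 'a measure \<Rightarrow> real \<Rightarrow> 'a measure" where
  "segment \<mu> \<nu> t = add_measure (scale_measure (ennreal (1 - t)) \<mu>) (scale_measure (ennreal t) \<nu>)"

lemma segment_finite_borel_measures:
  assumes "\<mu> \<in> finite_borel_measures" "\<nu> \<in> finite_borel_measures"
  shows "segment \<mu> \<nu> t \<in> finite_borel_measures"
  unfolding segment_def by (intro finite_borel_measures_add scale_finite_borel_measures assms)

lemma segment_ends:
  assumes "\<mu> \<in> finite_borel_measures" "\<nu> \<in> finite_borel_measures"
  shows "segment \<mu> \<nu> 0 = \<mu>" "segment \<mu> \<nu> 1 = \<nu>"
  using finite_borel_measuresD(1)[OF assms(1)] finite_borel_measuresD(1)[OF assms(2)]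
  by (auto intro!: measure_eqI simp: segment_def emeasure_add_measure simp del: scale_measure_0)

text \<open>The measures at times \<open>s\<close> and \<open>t\<close> share the part \<open>(1 - t) \<mu> + s \<nu>\<close>. What remains is \<open>(t - s) \<mu>\<close> at time \<open>s\<close>
and \<open>(t - s) \<nu>\<close> at time \<open>t\<close>.\<close>

lemma unbalanced_cost_segment_le:
  fixes \<mu> \<nu> :: "'a::polish_space measure"
  assumes M: "\<mu> \<in> finite_borel_measures" "\<nu> \<in> finite_borel_measures"
    and st: "0 \<le> s" "s < t" "t \<le> 1"
  shows "unbalanced_cost a b (segment \<mu> \<nu> s) (segment \<mu> \<nu> t) \<le> ennreal (t - s) * unbalanced_cost a b \<mu> \<nu>"
proof -
  let ?\<eta> = "add_measure (scale_measure (ennreal (1 - t)) \<mu>) (scale_measure (ennreal s) \<nu>)"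
  have sets [simp]: "sets \<nu> = sets \<mu>"
    using finite_borel_measuresD(1)[OF M(1)] finite_borel_measuresD(1)[OF M(2)] by simp
  have split: "ennreal (1 - s) = ennreal (t - s) + ennreal (1 - t)" "ennreal t = ennreal (t - s) + ennreal s"
    using st by (simp_all flip: ennreal_plus)
  have "segment \<mu> \<nu> s = add_measure (scale_measure (ennreal (t - s)) \<mu>) ?\<eta>"
    "segment \<mu> \<nu> t = add_measure (scale_measure (ennreal (t - s)) \<nu>) ?\<eta>"
    by (auto intro!: measure_eqI simp: segment_def emeasure_add_measure split distrib_right add_ac)
  then show ?thesis
    using unbalanced_cost_scale_add_le[of "t - s" \<mu> \<nu> ?\<eta> a b] st M
    by (simp add: finite_borel_measures_add scale_finite_borel_measures)
qed

text \<open>A curve is already a geodesic when its Lipschitz constant is at most the distance of its end points: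
the bounds for the steps of a subdivision telescope to this distance, and the subdivision without
interior points attains it.\<close>

lemma (in Metric_space) geodesic_if_Lipschitz:
  fixes \<gamma> :: "real \<Rightarrow> 'a"
  assumes in_M: "\<And>t. 0 \<le> t \<Longrightarrow> t \<le> 1 \<Longrightarrow> \<gamma> t \<in> M"
    and le: "\<And>s t. 0 \<le> s \<Longrightarrow> s \<le> t \<Longrightarrow> t \<le> 1 \<Longrightarrow> d (\<gamma> s) (\<gamma> t) \<le> (t - s) * d (\<gamma> 0) (\<gamma> 1)"
  shows "pathin mtopology \<gamma>" and "curve_length d \<gamma> = ennreal (d (\<gamma> 0) (\<gamma> 1))"
proof -
  define L where "L = d (\<gamma> 0) (\<gamma> 1)"
  have L: "0 \<le> L" by (simp add: L_def)
  have le': "d (\<gamma> s) (\<gamma> t) \<le> dist s t * L" if "s \<in> {0..1}" "t \<in> {0..1}" for s t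
    using le[of s t] le[of t s] that by (cases "s \<le> t") (auto simp: L_def dist_real_def commute)
  show "pathin mtopology \<gamma>"
    unfolding pathin_def continuous_map_to_metric
  proof (intro ballI allI impI)
    fix s e :: real
    assume s: "s \<in> topspace (top_of_set {0..1})" and e: "e > 0"
    \<comment> \<open>The distance \<open>L\<close> may be \<open>0\<close>, hence the denominator \<open>L + 1\<close>.\<close>
    let ?U = "{0..1} \<inter> ball s (e / (L + 1))"
    have "\<gamma> t \<in> mball (\<gamma> s) e" if t: "t \<in> ?U" for t
    proof -
      have "dist s t * L \<le> dist s t * (L + 1)" by (simp add: mult_left_mono)
      also have "\<dots> < e" using t L by (simp add: field_simps)
      finally show ?thesis using le'[of s t] s t in_M by (auto simp: in_mball)
    qed
    then show "\<exists>U. openin (top_of_set {0..1}) U \<and> s \<in> U \<and> (\<forall>t\<in>U. \<gamma> t \<in> mball (\<gamma> s) e)"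
      using s e L by (intro exI[of _ ?U]) (auto simp: openin_open)
  qed
  show "curve_length d \<gamma> = ennreal (d (\<gamma> 0) (\<gamma> 1))"
  proof (rule antisym)
    show "curve_length d \<gamma> \<le> ennreal (d (\<gamma> 0) (\<gamma> 1))"
      unfolding curve_length_def
    proof (rule SUP_least, clarify)
      fix n :: nat and t :: "nat \<Rightarrow> real"
      assume t: "mono_on {..n} t" "t 0 = 0" "t n = 1"
      have step: "ennreal (d (\<gamma> (t i)) (\<gamma> (t (Suc i)))) \<le> ennreal ((t (Suc i) - t i) * L)" if "i < n" for i
      proof -
        have "t 0 \<le> t i" "t i \<le> t (Suc i)" "t (Suc i) \<le> t n"
          using that by (auto intro!: mono_onD[OF t(1)])
        then show ?thesis using t le[of "t i" "t (Suc i)"] by (intro ennreal_leI) (simp add: L_def)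
      qed
      have "(\<Sum>i<n. ennreal (d (\<gamma> (t i)) (\<gamma> (t (Suc i))))) \<le> (\<Sum>i<n. ennreal ((t (Suc i) - t i) * L))"
        using step by (intro sum_mono) auto
      also have "\<dots> = ennreal (\<Sum>i<n. (t (Suc i) - t i) * L)"
        using L by (intro sum_ennreal mult_nonneg_nonneg) (auto intro!: mono_onD[OF t(1)])
      also have "(\<Sum>i<n. (t (Suc i) - t i) * L) = L"
        using t by (simp add: sum_lessThan_telescope flip: sum_distrib_right)
      finally show "(\<Sum>i<n. ennreal (d (\<gamma> (t i)) (\<gamma> (t (Suc i))))) \<le> ennreal (d (\<gamma> 0) (\<gamma> 1))"
        by (simp add: L_def)
    qed
    show "ennreal (d (\<gamma> 0) (\<gamma> 1)) \<le> curve_length d \<gamma>"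
      unfolding curve_length_def
      by (rule SUP_upper2[of "(1, real)"]) (auto simp: mono_on_def)
  qed
qed

theorem corollary1p3:
  fixes a b :: real
  assumes "a > 0" and "b > 0"
  shows "geodesic_space (finite_borel_measures :: 'a::polish_space measure set) (gen_wasserstein1 a b)"
  unfolding geodesic_space_def
proof (intro conjI ballI)
  show metric: "Metric_space (finite_borel_measures :: 'a measure set) (gen_wasserstein1 a b)"
    by (rule Metric_space_gen_wasserstein1[OF assms])
  interpret Metric_space "finite_borel_measures :: 'a measure set" "gen_wasserstein1 a b" by (rule metric)
  fix \<mu> \<nu> :: "'a measure"
  assume M: "\<mu> \<in> finite_borel_measures" "\<nu> \<in> finite_borel_measures"
  let ?\<gamma> = "segment \<mu> \<nu>"
  have ends: "?\<gamma> 0 = \<mu>" "?\<gamma> 1 = \<nu>" by (rule segment_ends[OF M])+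
  have in_M: "?\<gamma> t \<in> finite_borel_measures" for t by (rule segment_finite_borel_measures[OF M])
  have le: "gen_wasserstein1 a b (?\<gamma> s) (?\<gamma> t) \<le> (t - s) * gen_wasserstein1 a b (?\<gamma> 0) (?\<gamma> 1)"
    if "0 \<le> s" "s \<le> t" "t \<le> 1" for s t
  proof (cases "s = t")
    case True
    then show ?thesis using zero[OF in_M in_M, of t t] by simp
  next
    case False
    have "ennreal (gen_wasserstein1 a b (?\<gamma> s) (?\<gamma> t)) \<le> ennreal (t - s) * ennreal (gen_wasserstein1 a b \<mu> \<nu>)"
      using unbalanced_cost_segment_le[OF M, of s t a b] that False
      by (simp add: ennreal_gen_wasserstein1[OF assms] in_M M)
    also have "\<dots> = ennreal ((t - s) * gen_wasserstein1 a b \<mu> \<nu>)"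
      using that by (simp add: ennreal_mult)
    finally show ?thesis using that by (simp add: ends)
  qed
  show "\<exists>\<gamma>. pathin mtopology \<gamma> \<and> \<gamma> 0 = \<mu> \<and> \<gamma> 1 = \<nu>
      \<and> curve_length (gen_wasserstein1 a b) \<gamma> = ennreal (gen_wasserstein1 a b \<mu> \<nu>)"
    using geodesic_if_Lipschitz[of ?\<gamma>, OF in_M le] ends by (intro exI[of _ ?\<gamma>]) simp
qed

end
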